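(* Let $M$ be a compact smooth $m$-manifold with $m\ge 2$, and let $\varphi=(\varphi_1,\varphi_2)\colon M\to\mathbb{R}^2$ be a smooth function satisfying the standing assumptions (A)–(D) listed in the context. Fix a homology degree $k$, let $(a,b)\in\,]0,1[\,\times\mathbb{R}$, and let $P\in \mathrm{Dgm}_k\left(\varphi^*_{(a,b)}\right)\setminus\{\Delta\}$ be a (proper or at infinity) cornerpoint. Then, for each finite coordinate $w$ of $P$, there exists a point $A=(x^1_A,x^2_A)\in r_{(a,b)}\cap\Gamma(\varphi)$ such that $$w=\frac{\min\{a,1-a\}}{a}\,(x^1_A-b)=\frac{\min\{a,1-a\}}{1-a}\,(x^2_A+b).$$
   Context: Persistence diagrams. Homology is singular homology with coefficients in $\mathbb{Z}_2$. For a non-empty compact space $X$ and a continuous $f\colon X\to\mathbb{R}$ put $X^f_v=\{x\in X: f(x)\le v\}$ and $X^f_\infty=X$. Let $\Delta^+_1=\{(u,v)\in\mathbb{R}^2: u<v\}$ and $\Delta^*_1=\Delta^+_1\cup\{(u,\infty):u\in\mathbb{R}\}$. For $(u,v)\in\Delta_1^*$, $\beta^f_k(u,v)$ is the rank of the linear map $H_k(X^f_u)\to H_k(X^f_v)$ induced by inclusion. For $(u,v)\in\Delta^+_1$ set $\mu^f(u,v)=\lim_{\varepsilon\to0^+}\big(\beta^f_k(u+\varepsilon,v-\varepsilon)-\beta^f_k(u-\varepsilon,v-\varepsilon)+\beta^f_k(u-\varepsilon,v+\varepsilon)-\beta^f_k(u+\varepsilon,v+\varepsilon)\big)$, and set $\nu^f(u,\infty)=\lim_{\varepsilon\to0^+}\big(\beta^f_k(u+\varepsilon,\infty)-\beta^f_k(u-\varepsilon,\infty)\big)$.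 The persistence diagram $\mathrm{Dgm}_k(f)$ is the multiset consisting of the points $(u,v)\in\Delta_1^+$ with multiplicity $\mu^f(u,v)>0$ (proper cornerpoints), the points $(u,\infty)$ with multiplicity $\nu^f(u,\infty)>0$ (cornerpoints at infinity), and one additional point $\Delta$ with infinite multiplicity (trivial cornerpoint). Lines. For $(a,b)\in\,]0,1[\,\times\mathbb{R}$, $r_{(a,b)}$ is the line $\{t(a,1-a)+(b,-b): t\in\mathbb{R}\}\subset\mathbb{R}^2$, and $\varphi^*_{(a,b)}(x)=\min\{a,1-a\}\cdot\max\left\{\frac{\varphi_1(x)-b}{a},\frac{\varphi_2(x)+b}{1-a}\right\}$. Extended Pareto grid. A manifold is a smooth submanifold (without boundary) of some Euclidean space. The Jacobi set $\mathbb{J}(\varphi)$ is the set of $x\in M$ at which $\nabla\varphi_1(x)=\lambda\nabla\varphi_2(x)$ or $\nabla\varphi_2(x)=\lambda\nabla\varphi_1(x)$ for some $\lambda\in\mathbb{R}$; the set $\mathbb{J}_P(\varphi)$ of Pareto critical points consists of those $x$ for which this holds for some $\lambda\le 0$. The set of cusp points $\mathbb{J}_C(\varphi)$ is the set of points of $\mathbb{J}(\varphi)$ at which the restriction of $\varphi$ to $\mathbb{J}(\varphi)$ fails to be an immersion. The extended Pareto grid $\Gamma(\varphi)\subset\mathbb{R}^2$ is the union of $\varphi(\mathbb{J}_P(\varphi))$ with the closed vertical half-lines $\{(x^1,x^2): x^1=\varphi_1(p),\ x^2\ge\varphi_2(p)\}$, for $p$ a critical point of $\varphi_1$, and the closed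 horizontal half-lines $\{(x^1,x^2): x^1\ge\varphi_1(q),\ x^2=\varphi_2(q)\}$, for $q$ a critical point of $\varphi_2$. The connected components of $\mathbb{J}_P(\varphi)\setminus\mathbb{J}_C(\varphi)$ are called critical arcs; the closures of their images under $\varphi$ (proper contours) and the closed half-lines $\{(x^1,x^2): x^1=\varphi_1(p),\ x^2\ge\varphi_2(p)\}$, for $p$ a critical point of $\varphi_1$, and $\{(x^1,x^2): x^1\ge\varphi_1(q),\ x^2=\varphi_2(q)\}$, for $q$ a critical point of $\varphi_2$ (improper contours), are called contours. $\mathcal{S}(\varphi)$ is the set of points of $\Gamma(\varphi)$ belonging to more than one contour. When $\mathcal{S}(\varphi)$ consists of isolated points, the multiplicity of $A\in\Gamma(\varphi)$ is the greatest $n$ such that for every $\varepsilon>0$ there is a line $r_{(a,b)}$ with $(a,b)\in\,]0,1[\,\times\mathbb{R}$ that does not meet $\mathcal{S}(\varphi)$ and meets $\Gamma(\varphi)$ in exactly $n$ points inside the open Euclidean ball of radius $\varepsilon$ centred at $A$; $\mathcal{D}(\varphi)$ is the set of points of $\Gamma(\varphi)$ with multiplicity $>1$. The connected components of $\Gamma(\varphi)\setminus\mathcal{D}(\varphi)$ are called contour-arcs. Standing assumptions. Write $M^\varphi_{(u_1,u_2)}=\{x\in M:\varphi_1(x)\le u_1,\varphi_2(x)\le u_2\}$, also allowing $u_i=\infty$. (A) $H_k(M^\varphi_{(u_1,u_2)})$ is finite-dimensional for every $(u_1,u_2)\in\mathbb{R}^2$. (B) The function $\beta^\varphi_k((u_1,u_2),(v_1,v_2))=\operatorname{rank}\big(H_k(M^\varphi_{(u_1,u_2)})\to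 H_k(M^\varphi_{(v_1,v_2)})\big)$, defined for $(u_1,u_2)\in\mathbb{R}^2$, $(v_1,v_2)\in(\mathbb{R}\cup\{\infty\})^2$ with $u_1<v_1$, $u_2<v_2$, is right-continuous in each pair of variables: $\beta^\varphi_k((u_1+\varepsilon_1,u_2+\varepsilon_2),(v_1,v_2))$ and $\beta^\varphi_k((u_1,u_2),(v_1+\varepsilon_1,v_2+\varepsilon_2))$ both tend to $\beta^\varphi_k((u_1,u_2),(v_1,v_2))$ as $\varepsilon_1,\varepsilon_2\to0^+$. (C) (1) No point $x\in M$ has $\nabla\varphi_1(x)=\nabla\varphi_2(x)=0$. (2) $\mathbb{J}(\varphi)$ is a finite union of smooth compact 1-manifolds, each diffeomorphic to a circle. (3) $\mathbb{J}_P(\varphi)\setminus\mathbb{J}_C(\varphi)$ has finitely many connected components, each diffeomorphic to an interval, and each component can meet critical points of $\varphi_1,\varphi_2$ only at its endpoints. (4) With respect to any parameterization of each component of $\mathbb{J}_P(\varphi)\setminus\mathbb{J}_C(\varphi)$, one of $\varphi_1,\varphi_2$ is strictly increasing and the other strictly decreasing. (D) (1) For every two distinct critical arcs $\alpha_1,\alpha_2$, the restriction of $\varphi$ to $\alpha_1\cup\alpha_2$ is injective up to a finite number of points. (2) Every contour-arc $\gamma$ is associated with a pair $(d(\gamma),s(\gamma))\in\mathbb{Z}\times\{-1,1\}$ such that at each $(u_1,u_2)\in\gamma$, for every small enough $\varepsilon>0$, the map $i^k_*\colon H_k(M^\varphi_{(u_1-\varepsilon,u_2-\varepsilon)})\to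 H_k(M^\varphi_{(u_1+\varepsilon,u_2+\varepsilon)})$ induced by inclusion satisfies: if $k\ne d(\gamma)$ it is an isomorphism; if $k=d(\gamma)$ and $s(\gamma)=1$ it is injective and the dimension of the target is that of the source plus $1$; if $k=d(\gamma)$ and $s(\gamma)=-1$ it is surjective and the dimension of the target is that of the source minus $1$. *)

theory Defs
  imports "HOL-Homology.Homology" "HOL-Analysis.Analysis"
    "HOL-Library.Z2" "HOL-Library.Extended_Nat"
begin

section \<open>Singular homology with coefficients in \<open>\<int>\<^sub>2\<close>\<close>

text \<open>
  The homology groups of HOL-Homology have integer coefficients. The definitions below are
  their counterparts over the two-element field \<^typ>\<open>bit\<close>, based on the same singular simplices
  and face maps.
\<close>

type_synonym 'a chain2 = "((nat \<Rightarrow> real) \<Rightarrow> 'a) \<Rightarrow>\<^sub>0 bit"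

definition chains2 :: "nat \<Rightarrow> 'a topology \<Rightarrow> 'a chain2 set" where
  "chains2 p X = {c. Poly_Mapping.keys c \<subseteq> singular_simplex_set p X}"

definition boundary2 :: "nat \<Rightarrow> 'a chain2 \<Rightarrow> 'a chain2" where
  "boundary2 p c =
    (if p = 0 then 0
     else \<Sum>\<sigma>\<in>Poly_Mapping.keys c. \<Sum>i\<le>p.
            Poly_Mapping.single (singular_face p i \<sigma>) ((- 1) ^ i * Poly_Mapping.lookup c \<sigma>))"

definition cycle_group2 :: "nat \<Rightarrow> 'a topology \<Rightarrow> 'a chain2 monoid" where
  "cycle_group2 p X = \<lparr>carrier = {c \<in> chains2 p X. boundary2 p c = 0}, monoid.mult = (+), one = 0\<rparr>"

definition boundaries2 :: "nat \<Rightarrow> 'a topology \<Rightarrow> 'a chain2 set" where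
  "boundaries2 p X = boundary2 (Suc p) ` chains2 (Suc p) X"

definition homology2 :: "nat \<Rightarrow> 'a topology \<Rightarrow> 'a chain2 set monoid" where
  "homology2 p X = cycle_group2 p X Mod boundaries2 p X"

text \<open>
  For a subspace \<open>S \<subseteq> T\<close> the chain map of the inclusion is the identity on chains, because a
  singular simplex is a plain function that is undefined outside the standard simplex. The induced
  map sends the class \<open>c + B(S)\<close> to \<open>c + B(T)\<close>, which is the set sum of \<open>B(T)\<close> and \<open>c + B(S)\<close>.
\<close>

definition hom_incl2 :: "nat \<Rightarrow> 'a topology \<Rightarrow> 'a chain2 set \<Rightarrow> 'a chain2 set" where
  "hom_incl2 p Y C = boundaries2 p Y <#>\<^bsub>cycle_group2 p Y\<^esub> C"

text \<open>
  A vector space over \<open>\<int>\<^sub>2\<close> is an abelian group of exponent two, and its linear spans are the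
  generated subgroups. The dimension is the least size of a finite spanning set; it is meant
  for finite-dimensional spaces only.
\<close>

definition z2_finite_dim :: "('c, 'd) monoid_scheme \<Rightarrow> bool" where
  "z2_finite_dim V \<longleftrightarrow> (\<exists>B. finite B \<and> B \<subseteq> carrier V \<and> generate V B = carrier V)"

definition z2_dim :: "('c, 'd) monoid_scheme \<Rightarrow> nat" where
  "z2_dim V = (LEAST n. \<exists>B. finite B \<and> B \<subseteq> carrier V \<and> generate V B = carrier V \<and> card B = n)"

definition incl_rank2 :: "nat \<Rightarrow> 'a topology \<Rightarrow> 'a topology \<Rightarrow> nat" where
  "incl_rank2 p X Y =
    z2_dim ((homology2 p Y)\<lparr>carrier := hom_incl2 p Y ` carrier (homology2 p X)\<rparr>)"

section \<open>Persistence diagrams\<close>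

definition sublevel :: "'a set \<Rightarrow> ('a \<Rightarrow> real) \<Rightarrow> ereal \<Rightarrow> 'a set" where
  "sublevel X f v = {x \<in> X. ereal (f x) \<le> v}"

definition pers_betti ::
    "nat \<Rightarrow> 'a::topological_space set \<Rightarrow> ('a \<Rightarrow> real) \<Rightarrow> real \<Rightarrow> ereal \<Rightarrow> nat" where
  "pers_betti k X f u v = incl_rank2 k (top_of_set (sublevel X f (ereal u))) (top_of_set (sublevel X f v))"

text \<open>The multiplicities are limits of integers and are taken in the discrete space \<^typ>\<open>int\<close>.\<close>

definition proper_mult ::
    "nat \<Rightarrow> 'a::topological_space set \<Rightarrow> ('a \<Rightarrow> real) \<Rightarrow> real \<Rightarrow> real \<Rightarrow> int" where
  "proper_mult k X f u v =
    Lim (at_right (0::real)) (\<lambda>\<epsilon>.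
        int (pers_betti k X f (u + \<epsilon>) (ereal (v - \<epsilon>))) - int (pers_betti k X f (u - \<epsilon>) (ereal (v - \<epsilon>)))
      + int (pers_betti k X f (u - \<epsilon>) (ereal (v + \<epsilon>))) - int (pers_betti k X f (u + \<epsilon>) (ereal (v + \<epsilon>))))"

definition infinite_mult ::
    "nat \<Rightarrow> 'a::topological_space set \<Rightarrow> ('a \<Rightarrow> real) \<Rightarrow> real \<Rightarrow> int" where
  "infinite_mult k X f u =
    Lim (at_right (0::real)) (\<lambda>\<epsilon>. int (pers_betti k X f (u + \<epsilon>) \<infinity>) - int (pers_betti k X f (u - \<epsilon>) \<infinity>))"

datatype cornerpoint = Proper real real | At_Infinity real | Trivial

text \<open>The persistence diagram, a multiset with one point of infinite multiplicity, is
  given by its multiplicity function.\<close>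

definition Dgm ::
    "nat \<Rightarrow> 'a::topological_space set \<Rightarrow> ('a \<Rightarrow> real) \<Rightarrow> cornerpoint \<Rightarrow> enat" where
  "Dgm k X f P =
    (case P of
       Proper u v \<Rightarrow> (if u < v then enat (nat (proper_mult k X f u v)) else 0)
     | At_Infinity u \<Rightarrow> enat (nat (infinite_mult k X f u))
     | Trivial \<Rightarrow> \<infinity>)"

definition Dgm_points ::
    "nat \<Rightarrow> 'a::topological_space set \<Rightarrow> ('a \<Rightarrow> real) \<Rightarrow> cornerpoint set" where
  "Dgm_points k X f = {P. Dgm k X f P > 0}"

fun finite_coordinates :: "cornerpoint \<Rightarrow> real set" where
  "finite_coordinates (Proper u v) = {u, v}"
| "finite_coordinates (At_Infinity u) = {u}"
| "finite_coordinates Trivial = {}"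

section \<open>Smooth maps and submanifolds of Euclidean space\<close>

fun times_differentiable_on ::
    "nat \<Rightarrow> ('a::euclidean_space \<Rightarrow> 'b::real_normed_vector) \<Rightarrow> 'a set \<Rightarrow> bool" where
  "times_differentiable_on 0 f U \<longleftrightarrow> continuous_on U f"
| "times_differentiable_on (Suc n) f U \<longleftrightarrow>
     (\<forall>x\<in>U. f differentiable at x) \<and>
     (\<forall>v. times_differentiable_on n (\<lambda>x. frechet_derivative f (at x) v) U)"

text \<open>A map on an arbitrary subset is smooth if it extends locally to \<open>C\<^sup>\<infinity>\<close> maps on open sets of
  the ambient space.\<close>

definition smooth_on ::
    "'a::euclidean_space set \<Rightarrow> ('a \<Rightarrow> 'b::real_normed_vector) \<Rightarrow> bool" where
  "smooth_on S f \<longleftrightarrow>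
    (\<forall>x\<in>S. \<exists>U g. open U \<and> x \<in> U \<and> (\<forall>n. times_differentiable_on n g U) \<and> (\<forall>y\<in>S \<inter> U. f y = g y))"

definition diffeomorphism ::
    "'a::euclidean_space set \<Rightarrow> 'b::euclidean_space set \<Rightarrow> ('a \<Rightarrow> 'b) \<Rightarrow> bool" where
  "diffeomorphism S T f \<longleftrightarrow> bij_betw f S T \<and> smooth_on S f \<and> smooth_on T (inv_into S f)"

definition diffeomorphic :: "'a::euclidean_space set \<Rightarrow> 'b::euclidean_space set \<Rightarrow> bool" where
  "diffeomorphic S T \<longleftrightarrow> (\<exists>f. diffeomorphism S T f)"

text \<open>The definition uses slice charts of the ambient space; the model space \<open>\<real>\<^sup>m\<close> is an \<open>m\<close>-dimensional linear subspace.\<close>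

definition smooth_submanifold :: "nat \<Rightarrow> 'a::euclidean_space set \<Rightarrow> bool" where
  "smooth_submanifold m M \<longleftrightarrow>
    (\<forall>x\<in>M. \<exists>U V L h. open U \<and> x \<in> U \<and> open V \<and> diffeomorphism U V h \<and>
       subspace (L :: 'a set) \<and> dim L = m \<and> h ` (M \<inter> U) = V \<inter> L)"

definition smooth_curve_through ::
    "'a::euclidean_space set \<Rightarrow> 'a \<Rightarrow> (real \<Rightarrow> 'a) \<Rightarrow> 'a \<Rightarrow> bool" where
  "smooth_curve_through S x c v \<longleftrightarrow>
    (\<exists>e>0. smooth_on {- e<..<e} c \<and> c ` {- e<..<e} \<subseteq> S) \<and> c 0 = x \<and>
    (c has_vector_derivative v) (at 0)"

definition tangent_space :: "'a::euclidean_space set \<Rightarrow> 'a \<Rightarrow> 'a set" where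
  "tangent_space S x = {v. \<exists>c. smooth_curve_through S x c v}"

text \<open>The gradient with respect to the Riemannian metric inherited from the ambient space.\<close>

definition manifold_gradient ::
    "'a::euclidean_space set \<Rightarrow> ('a \<Rightarrow> real) \<Rightarrow> 'a \<Rightarrow> 'a" where
  "manifold_gradient M f x =
    (THE g. g \<in> tangent_space M x \<and>
       (\<forall>c v. smooth_curve_through M x c v \<longrightarrow> (f \<circ> c has_real_derivative g \<bullet> v) (at 0)))"

definition critical_points :: "'a::euclidean_space set \<Rightarrow> ('a \<Rightarrow> real) \<Rightarrow> 'a set" where
  "critical_points M f = {x \<in> M. manifold_gradient M f x = 0}"

text \<open>The restriction of \<open>f\<close> to \<open>S\<close> is an immersion at \<open>x\<close> if its differential, the linear map
  \<open>c'(0) \<mapsto> (f \<circ> c)'(0)\<close>, has trivial kernel.\<close>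

definition immersion_at ::
    "'a::euclidean_space set \<Rightarrow> ('a \<Rightarrow> 'b::euclidean_space) \<Rightarrow> 'a \<Rightarrow> bool" where
  "immersion_at S f x \<longleftrightarrow>
    (\<forall>c v. smooth_curve_through S x c v \<and> (f \<circ> c has_vector_derivative 0) (at 0) \<longrightarrow> v = 0)"

section \<open>The extended Pareto grid\<close>

context
  fixes M :: "'a::euclidean_space set" and \<phi> :: "'a \<Rightarrow> real \<times> real"
begin

abbreviation grad1 :: "'a \<Rightarrow> 'a" where "grad1 \<equiv> manifold_gradient M (fst \<circ> \<phi>)"
abbreviation grad2 :: "'a \<Rightarrow> 'a" where "grad2 \<equiv> manifold_gradient M (snd \<circ> \<phi>)"

definition jacobi_set :: "'a set" where
  "jacobi_set = {x \<in> M. \<exists>l::real. grad1 x = l *\<^sub>R grad2 x \<or> grad2 x = l *\<^sub>R grad1 x}"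

definition pareto_critical :: "'a set" where
  "pareto_critical = {x \<in> M. \<exists>l\<le>0. grad1 x = l *\<^sub>R grad2 x \<or> grad2 x = l *\<^sub>R grad1 x}"

definition cusp_points :: "'a set" where
  "cusp_points = {x \<in> jacobi_set. \<not> immersion_at jacobi_set \<phi> x}"

definition vertical_half_line :: "'a \<Rightarrow> (real \<times> real) set" where
  "vertical_half_line p = {(x1, x2). x1 = fst (\<phi> p) \<and> x2 \<ge> snd (\<phi> p)}"

definition horizontal_half_line :: "'a \<Rightarrow> (real \<times> real) set" where
  "horizontal_half_line q = {(x1, x2). x1 \<ge> fst (\<phi> q) \<and> x2 = snd (\<phi> q)}"

definition pareto_grid :: "(real \<times> real) set" where
  "pareto_grid = \<phi> ` pareto_critical
     \<union> (\<Union>p\<in>critical_points M (fst \<circ> \<phi>). vertical_half_line p)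
     \<union> (\<Union>q\<in>critical_points M (snd \<circ> \<phi>). horizontal_half_line q)"

definition critical_arcs :: "'a set set" where
  "critical_arcs = components (pareto_critical - cusp_points)"

definition contours :: "(real \<times> real) set set" where
  "contours = (\<lambda>\<alpha>. closure (\<phi> ` \<alpha>)) ` critical_arcs
     \<union> vertical_half_line ` critical_points M (fst \<circ> \<phi>)
     \<union> horizontal_half_line ` critical_points M (snd \<circ> \<phi>)"

text \<open>Contours are subsets of the plane, so coinciding half-lines of different critical points
  are one contour.\<close>

definition multi_contour_points :: "(real \<times> real) set" where
  "multi_contour_points =
    {A \<in> pareto_grid. \<exists>C\<in>contours. \<exists>C'\<in>contours. C \<noteq> C' \<and> A \<in> C \<and> A \<in> C'}"

definition filter_line :: "real \<Rightarrow> real \<Rightarrow> (real \<times> real) set" where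
  "filter_line a b = {(t * a + b, t * (1 - a) - b) | t. True}"

definition grid_multiplicity :: "real \<times> real \<Rightarrow> nat" where
  "grid_multiplicity A =
    (GREATEST n. \<forall>\<epsilon>>0. \<exists>a b. 0 < a \<and> a < 1 \<and> filter_line a b \<inter> multi_contour_points = {} \<and>
       finite (filter_line a b \<inter> pareto_grid \<inter> ball A \<epsilon>) \<and>
       card (filter_line a b \<inter> pareto_grid \<inter> ball A \<epsilon>) = n)"

definition double_points :: "(real \<times> real) set" where
  "double_points = {A \<in> pareto_grid. grid_multiplicity A > 1}"

definition contour_arcs :: "(real \<times> real) set set" where
  "contour_arcs = components (pareto_grid - double_points)"

section \<open>Standing assumptions\<close>

definition bisublevel :: "ereal \<Rightarrow> ereal \<Rightarrow> 'a set" where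
  "bisublevel u1 u2 = {x \<in> M. ereal (fst (\<phi> x)) \<le> u1 \<and> ereal (snd (\<phi> x)) \<le> u2}"

definition bi_betti :: "nat \<Rightarrow> real \<Rightarrow> real \<Rightarrow> ereal \<Rightarrow> ereal \<Rightarrow> nat" where
  "bi_betti k u1 u2 v1 v2 =
    incl_rank2 k (top_of_set (bisublevel (ereal u1) (ereal u2))) (top_of_set (bisublevel v1 v2))"

definition finite_sublevel_homology :: "nat \<Rightarrow> bool" where
  "finite_sublevel_homology k \<longleftrightarrow>
    (\<forall>u1 u2. z2_finite_dim (homology2 k (top_of_set (bisublevel (ereal u1) (ereal u2)))))"

text \<open>The inequalities \<open>u\<^sub>i < v\<^sub>i\<close> force \<open>v\<^sub>i \<noteq> -\<infinity>\<close>, and \<open>\<infinity> + \<epsilon> = \<infinity>\<close> in \<^typ>\<open>ereal\<close>.\<close>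

definition right_continuous_betti :: "nat \<Rightarrow> bool" where
  "right_continuous_betti k \<longleftrightarrow>
    (\<forall>u1 u2 v1 v2. ereal u1 < v1 \<and> ereal u2 < v2 \<longrightarrow>
       ((\<lambda>(e1, e2). bi_betti k (u1 + e1) (u2 + e2) v1 v2) \<longlongrightarrow> bi_betti k u1 u2 v1 v2)
         (at_right 0 \<times>\<^sub>F at_right 0) \<and>
       ((\<lambda>(e1, e2). bi_betti k u1 u2 (v1 + ereal e1) (v2 + ereal e2)) \<longlongrightarrow> bi_betti k u1 u2 v1 v2)
         (at_right 0 \<times>\<^sub>F at_right 0))"

text \<open>A component of the Pareto critical set without the cusps may contain none, one or both of its
  endpoints. They are the points that correspond to the endpoints of the parameter interval \<open>I\<close>, and
  all other points correspond to the interior of \<open>I\<close>.\<close>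

definition regular_pareto_set :: "bool" where
  "regular_pareto_set \<longleftrightarrow>
    (\<forall>x\<in>M. \<not> (grad1 x = 0 \<and> grad2 x = 0)) \<and>
    (\<exists>\<C>. finite \<C> \<and> jacobi_set = \<Union>\<C> \<and>
       (\<forall>C\<in>\<C>. smooth_submanifold 1 C \<and> compact C \<and> diffeomorphic C (sphere (0 :: real \<times> real) 1))) \<and>
    finite critical_arcs \<and>
    (\<forall>\<alpha>\<in>critical_arcs. \<exists>(I :: real set) h. is_interval I \<and> diffeomorphism I \<alpha> h \<and>
       (\<forall>t\<in>interior I. h t \<notin> critical_points M (fst \<circ> \<phi>) \<and> h t \<notin> critical_points M (snd \<circ> \<phi>))) \<and>
    (\<forall>\<alpha>\<in>critical_arcs. \<forall>(I :: real set) h. is_interval I \<and> diffeomorphism I \<alpha> h \<longrightarrow>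
       (strict_mono_on I (fst \<circ> \<phi> \<circ> h) \<and> strict_antimono_on I (snd \<circ> \<phi> \<circ> h)) \<or>
       (strict_antimono_on I (fst \<circ> \<phi> \<circ> h) \<and> strict_mono_on I (snd \<circ> \<phi> \<circ> h)))"

definition crossing_type :: "nat \<Rightarrow> int \<Rightarrow> int \<Rightarrow> 'a topology \<Rightarrow> 'a topology \<Rightarrow> bool" where
  "crossing_type k d s X Y \<longleftrightarrow>
    (let G = homology2 k X; H = homology2 k Y; i = hom_incl2 k Y in
      (int k \<noteq> d \<longrightarrow> i \<in> iso G H) \<and>
      (int k = d \<and> s = 1 \<longrightarrow> inj_on i (carrier G) \<and> int (z2_dim H) = int (z2_dim G) + 1) \<and>
      (int k = d \<and> s = - 1 \<longrightarrow> i ` carrier G = carrier H \<and> int (z2_dim H) = int (z2_dim G) - 1))"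

definition regular_contour_arcs :: "nat \<Rightarrow> bool" where
  "regular_contour_arcs k \<longleftrightarrow>
    (\<forall>\<alpha>\<in>critical_arcs. \<forall>\<beta>\<in>critical_arcs. \<alpha> \<noteq> \<beta> \<longrightarrow> (\<exists>F. finite F \<and> inj_on \<phi> ((\<alpha> \<union> \<beta>) - F))) \<and>
    (\<forall>\<gamma>\<in>contour_arcs. \<exists>d::int. \<exists>s\<in>{- 1, 1::int}. \<forall>(u1, u2)\<in>\<gamma>. \<forall>\<^sub>F \<epsilon> in at_right (0::real).
       crossing_type k d s (top_of_set (bisublevel (ereal (u1 - \<epsilon>)) (ereal (u2 - \<epsilon>))))
                           (top_of_set (bisublevel (ereal (u1 + \<epsilon>)) (ereal (u2 + \<epsilon>)))))"

definition phi_star :: "real \<Rightarrow> real \<Rightarrow> 'a \<Rightarrow> real" where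
  "phi_star a b x = min a (1 - a) * max ((fst (\<phi> x) - b) / a) ((snd (\<phi> x) + b) / (1 - a))"

end

end

(* Suppose that the point of the line r_(a,b) with parameter w / min {a, 1-a} is not on the extended
   Pareto grid. Then every x with phi*(x) = w has a tangent direction along which those of phi_1, phi_2
   that realise the maximum in phi* decrease. Moving points a small, cut-off distance in this direction
   inside a slice chart is a homotopy of M that never increases phi* and decreases it strictly near x.
   Composing finitely many of these homotopies pushes {phi* <= w + e} into {phi* <= w - e} for some
   e > 0; no gradient flow is needed. Homotopy invariance of singular homology then makes the
   persistent Betti numbers constant when one of their arguments varies in [w - e, w + e], so all
   multiplicities of cornerpoints with coordinate w vanish. *)

theory Submission
  imports Defs
begin

section \<open>Prism operator for singular chains over \<open>\<int>\<^sub>2\<close>\<close>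

text \<open>The point A with parameter \<open>w / min a (1 - a)\<close> is the corner of the
  quadrant that cuts the sublevel set of \<open>phi_star\<close> at w out of M. This explains the
  half-lines of the grid: if x lies on the level w and only phi_2 attains the maximum, then phi_2(x)
  is the second coordinate of A while phi_1(x) is smaller than the first, so x cannot be critical
  for phi_2 unless A is on its horizontal half-line; the vertical ones arise in the same way. If
  both terms attain the maximum, then phi(x) = A, and x outside the Pareto critical set means that
  the gradients are nonzero and not oppositely directed, which leaves a common descent direction.
  The obstacle is that \<open>phi_star\<close> need not be differentiable where its two terms agree.
  Therefore the new value of each term is compared with the old value of the maximum: an active term
  decreases by its derivative, an inactive one has slack by continuity. The homotopies must preserve
  sublevel sets at all times and not only at the end, because the prism over a cycle has to stay in
  the space in which it bounds.\<close>

definition zext :: "('s \<Rightarrow> 't \<Rightarrow>\<^sub>0 bit) \<Rightarrow> ('s \<Rightarrow>\<^sub>0 bit) \<Rightarrow> ('t \<Rightarrow>\<^sub>0 bit)" where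
  "zext F c = (\<Sum>\<sigma>\<in>Poly_Mapping.keys c. F \<sigma>)"

lemma bit_mapping_add_self [simp]: "(x :: 't \<Rightarrow>\<^sub>0 bit) + x = 0"
  by (rule poly_mapping_eqI) (simp add: lookup_add)

text \<open>Over Z_2 a chain is just its finite support, which is why \<open>zext\<close> has no
  coefficients. Supports cancel under addition, though, so additivity needs a sum over one fixed
  finite set that contains all supports involved.\<close>

lemma zext_superset:
  assumes "finite S" "Poly_Mapping.keys c \<subseteq> S"
  shows "zext F c = (\<Sum>\<sigma>\<in>S. if Poly_Mapping.lookup c \<sigma> = 1 then F \<sigma> else 0)"
proof -
  have "zext F c = (\<Sum>\<sigma>\<in>Poly_Mapping.keys c. if Poly_Mapping.lookup c \<sigma> = 1 then F \<sigma> else 0)"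
    unfolding zext_def by (rule sum.cong) (auto simp: in_keys_iff)
  also have "\<dots> = (\<Sum>\<sigma>\<in>S. if Poly_Mapping.lookup c \<sigma> = 1 then F \<sigma> else 0)"
    using assms by (intro sum.mono_neutral_left) (auto simp: in_keys_iff)
  finally show ?thesis .
qed

lemma zext_0 [simp]: "zext F 0 = 0"
  by (simp add: zext_def)

lemma zext_single [simp]: "zext F (Poly_Mapping.single \<sigma> 1) = F \<sigma>"
  by (simp add: zext_def)

lemma zext_add:
  fixes F :: "'s \<Rightarrow> 't \<Rightarrow>\<^sub>0 bit"
  shows "zext F (c + d) = zext F c + zext F d"
proof -
  define S where "S = Poly_Mapping.keys c \<union> Poly_Mapping.keys d"
  have S: "finite S" "Poly_Mapping.keys c \<subseteq> S" "Poly_Mapping.keys d \<subseteq> S"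
    "Poly_Mapping.keys (c + d) \<subseteq> S"
    using keys_add[of c d] by (auto simp: S_def)
  \<comment> \<open>The indicator of the value 1 is additive on bits because
    \<open>a + a = 0\<close> takes care of \<open>x = y = 1\<close>.\<close>
  have *: "(if x + y = 1 then a else 0) = (if x = 1 then a else 0) + (if y = 1 then a else 0)"
    for x y :: bit and a :: "'t \<Rightarrow>\<^sub>0 bit"
    by (cases x; cases y) simp_all
  show ?thesis
    by (simp only: zext_superset[OF S(1)] S lookup_add * sum.distrib)
qed

lemma zext_sum: "zext F (\<Sum>i\<in>I. g i) = (\<Sum>i\<in>I. zext F (g i))"
  by (induction I rule: infinite_finite_induct) (simp_all add: zext_add)

lemma zext_zext: "zext F (zext G c) = zext (\<lambda>\<sigma>. zext F (G \<sigma>)) c"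
  unfolding zext_def[of G] zext_def[of _ c] by (rule zext_sum)

lemma zext_fun_add: "zext (\<lambda>\<sigma>. F \<sigma> + G \<sigma>) c = zext F c + zext G c"
  by (simp add: zext_def sum.distrib)

lemma zext_cong: "(\<And>\<sigma>. \<sigma> \<in> Poly_Mapping.keys c \<Longrightarrow> F \<sigma> = G \<sigma>) \<Longrightarrow> zext F c = zext G c"
  by (simp add: zext_def)

lemma zext_identity: "zext (\<lambda>\<sigma>. Poly_Mapping.single \<sigma> 1) c = c"
proof (rule poly_mapping_eqI)
  fix k
  have "Poly_Mapping.lookup (zext (\<lambda>\<sigma>. Poly_Mapping.single \<sigma> 1) c) k
      = (\<Sum>\<sigma>\<in>Poly_Mapping.keys c. if \<sigma> = k then 1 else 0)"
    unfolding zext_def by (simp add: lookup_sum lookup_single when_def)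
  also have "\<dots> = Poly_Mapping.lookup c k"
    by (auto simp: in_keys_iff)
  finally show "Poly_Mapping.lookup (zext (\<lambda>\<sigma>. Poly_Mapping.single \<sigma> 1) c) k = Poly_Mapping.lookup c k" .
qed

section \<open>Chains and the boundary operator over Z_2\<close>

lemma chains2_0 [simp]: "0 \<in> chains2 p X"
  by (simp add: chains2_def)

lemma chains2_add: "c \<in> chains2 p X \<Longrightarrow> d \<in> chains2 p X \<Longrightarrow> c + d \<in> chains2 p X"
  using keys_add[of c d] by (auto simp: chains2_def)

lemma chains2_sum: "(\<And>i. i \<in> I \<Longrightarrow> g i \<in> chains2 p X) \<Longrightarrow> (\<Sum>i\<in>I. g i) \<in> chains2 p X"
  by (induction I rule: infinite_finite_induct) (simp_all add: chains2_add)

lemma chains2_single: "singular_simplex p X \<sigma> \<Longrightarrow> Poly_Mapping.single \<sigma> 1 \<in> chains2 p X"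
  by (simp add: chains2_def)

lemma chains2_zext:
  "c \<in> chains2 p X \<Longrightarrow> (\<And>\<sigma>. singular_simplex p X \<sigma> \<Longrightarrow> F \<sigma> \<in> chains2 q Y) \<Longrightarrow> zext F c \<in> chains2 q Y"
  unfolding zext_def by (rule chains2_sum) (auto simp: chains2_def)

lemma chains2_mono:
  "c \<in> chains2 p (top_of_set S) \<Longrightarrow> S \<subseteq> T \<Longrightarrow> c \<in> chains2 p (top_of_set T)"
  unfolding chains2_def using singular_simplex_mono by blast

definition face_sum :: "nat \<Rightarrow> ((nat \<Rightarrow> real) \<Rightarrow> 'a) \<Rightarrow> 'a chain2" where
  "face_sum p \<sigma> = (\<Sum>i\<le>p. Poly_Mapping.single (singular_face p i \<sigma>) 1)"

lemma boundary2_0 [simp]: "boundary2 0 c = 0"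
  by (simp add: boundary2_def)

text \<open>The sign \<open>(- 1) ^ i\<close> is 1 in \<open>bit\<close> and every key has
  coefficient 1, so the boundary is an unsigned linear extension and \<open>zext_zext\<close>
  applies to its composites.\<close>

lemma boundary2_Suc: "boundary2 (Suc p) c = zext (face_sum (Suc p)) c"
  unfolding boundary2_def zext_def face_sum_def
  by (auto intro!: sum.cong simp: in_keys_iff)

lemma boundary2_zero [simp]: "boundary2 p 0 = 0"
  by (simp add: boundary2_def)

lemma boundary2_add: "boundary2 p (c + d) = boundary2 p c + boundary2 p d"
  by (cases p) (simp_all add: boundary2_Suc zext_add)

lemma boundary2_chains2:
  assumes "c \<in> chains2 (Suc p) X"
  shows "boundary2 (Suc p) c \<in> chains2 p X"
  unfolding boundary2_Suc face_sum_def
  using singular_simplex_singular_face[of "Suc p" X]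
  by (intro chains2_zext[OF assms] chains2_sum chains2_single) auto

text \<open>The simplicial identity for double faces: for \<open>j \<le> i\<close>, inserting a zero
  at \<open>i\<close> and then one at \<open>j\<close> is the same as inserting at \<open>j\<close>
  and then at \<open>Suc i\<close>.\<close>

lemma singular_face_singular_face:
  assumes "j \<le> i" "i \<le> Suc p"
  shows "singular_face (Suc p) i (singular_face (Suc (Suc p)) j \<sigma>)
       = singular_face (Suc p) j (singular_face (Suc (Suc p)) (Suc i) \<sigma>)"
proof (rule ext)
  fix x :: "nat \<Rightarrow> real"
  have "simplical_face j (simplical_face i x) = simplical_face (Suc i) (simplical_face j x)"
    using assms by (auto simp: simplical_face_def fun_eq_iff)
  moreover have "simplical_face i x \<in> standard_simplex (Suc p)" "simplical_face j x \<in> standard_simplex (Suc p)"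
    if "x \<in> standard_simplex p"
    using that assms by (auto intro!: simplical_face_in_standard_simplex)
  ultimately show "singular_face (Suc p) i (singular_face (Suc (Suc p)) j \<sigma>) x
       = singular_face (Suc p) j (singular_face (Suc (Suc p)) (Suc i) \<sigma>) x"
    by (simp add: singular_face_def)
qed

text \<open>Every double face arises from two ordered pairs of deleted vertices, and the two copies
  cancel in characteristic two.\<close>

lemma boundary2_boundary2: "boundary2 p (boundary2 (Suc p) c) = 0"
proof (cases p)
  case (Suc q)
  have "zext (face_sum (Suc q)) (face_sum (Suc (Suc q)) \<sigma>) = 0"
    for \<sigma> :: "(nat \<Rightarrow> real) \<Rightarrow> 'a"
  proof -
    let ?f = "\<lambda>(j,i). Poly_Mapping.single (singular_face (Suc q) i (singular_face (Suc (Suc q)) j \<sigma>)) (1::bit)"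
    \<comment> \<open>In a pair \<open>(j, i)\<close> the face \<open>j\<close> is taken first. The
      simplicial identity matches \<open>(j, i)\<close> in \<open>A\<close> with
      \<open>(Suc i, j)\<close> in \<open>B\<close>.\<close>
    define A where "A = {(j,i). j \<le> i \<and> i \<le> Suc q}"
    define B where "B = {(j,i). i < j \<and> j \<le> Suc (Suc q)}"
    have AB: "A \<union> B = {..Suc (Suc q)} \<times> {..Suc q}" "A \<inter> B = {}"
      by (auto simp: A_def B_def)
    then have fin: "finite A" "finite B"
      by (metis finite_Un finite_SigmaI finite_atMost)+
    have "sum ?f A = sum ?f B"
      by (rule sum.reindex_bij_witness[where i = "\<lambda>(j,i). (i, j - 1)" and j = "\<lambda>(j,i). (Suc i, j)"])
        (auto simp: A_def B_def singular_face_singular_face)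
    moreover have "zext (face_sum (Suc q)) (face_sum (Suc (Suc q)) \<sigma>) = sum ?f (A \<union> B)"
      unfolding AB face_sum_def[of "Suc (Suc q)"] zext_sum zext_single
      unfolding face_sum_def sum.cartesian_product ..
    ultimately show ?thesis
      by (simp add: sum.union_disjoint[OF fin AB(2)])
  qed
  then show ?thesis
    unfolding Suc boundary2_Suc zext_zext by (simp add: zext_def)
qed simp

text \<open>The simplices of the usual triangulation of the prism; the \<open>[0,1]\<close>-coordinate is the sum of
  the last barycentric coordinates.\<close>

definition simplical_degeneracy :: "nat \<Rightarrow> (nat \<Rightarrow> real) \<Rightarrow> nat \<Rightarrow> real" where
  "simplical_degeneracy i x = (\<lambda>j. if j < i then x j else if j = i then x i + x (Suc i) else x (Suc j))"

definition prism_simplex ::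
    "nat \<Rightarrow> nat \<Rightarrow> (real \<times> 'a \<Rightarrow> 'b) \<Rightarrow> ((nat \<Rightarrow> real) \<Rightarrow> 'a) \<Rightarrow> (nat \<Rightarrow> real) \<Rightarrow> 'b" where
  "prism_simplex p i H \<sigma> =
     restrict (\<lambda>x. H (\<Sum>l\<in>{i<..Suc p}. x l, \<sigma> (simplical_degeneracy i x))) (standard_simplex (Suc p))"

text \<open>For index \<open>i\<close> between 1 and \<open>p\<close> this is the common face of the
  prism simplices \<open>i - 1\<close> and \<open>i\<close>. The sections \<open>0\<close> and
  \<open>Suc p\<close> have constant heights 1 (the full sum) and 0 (the empty sum), so they are the
  two ends of the homotopy.\<close>

definition prism_section ::
    "nat \<Rightarrow> nat \<Rightarrow> (real \<times> 'a \<Rightarrow> 'b) \<Rightarrow> ((nat \<Rightarrow> real) \<Rightarrow> 'a) \<Rightarrow> (nat \<Rightarrow> real) \<Rightarrow> 'b" where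
  "prism_section p i H \<sigma> = restrict (\<lambda>x. H (\<Sum>l\<in>{i..p}. x l, \<sigma> x)) (standard_simplex p)"

definition prism :: "nat \<Rightarrow> (real \<times> 'a \<Rightarrow> 'b) \<Rightarrow> 'a chain2 \<Rightarrow> 'b chain2" where
  "prism p H = zext (\<lambda>\<sigma>. \<Sum>i\<le>p. Poly_Mapping.single (prism_simplex p i H \<sigma>) 1)"

definition chain_map2 :: "nat \<Rightarrow> ('a \<Rightarrow> 'b) \<Rightarrow> 'a chain2 \<Rightarrow> 'b chain2" where
  "chain_map2 p f = zext (\<lambda>\<sigma>. Poly_Mapping.single (simplex_map p f \<sigma>) 1)"

lemma simplical_degeneracy_in_standard_simplex:
  assumes "x \<in> standard_simplex (Suc p)" "i \<le> p"
  shows "simplical_degeneracy i x \<in> standard_simplex p"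
proof -
  have x: "\<And>i. 0 \<le> x i" "\<And>i. Suc p < i \<Longrightarrow> x i = 0" "(\<Sum>i\<le>Suc p. x i) = 1"
    using assms by (auto simp: standard_simplex_def)
  \<comment> \<open>The merged coordinate \<open>j = i\<close> is the only one that satisfies both
    conditions, and it is there that \<open>x i\<close> and \<open>x (Suc i)\<close> are
    added.\<close>
  have "(\<Sum>j\<le>p. simplical_degeneracy i x j)
      = (\<Sum>j\<le>p. (if j \<le> i then x j else 0) + (if i \<le> j then x (Suc j) else 0))"
    by (rule sum.cong) (auto simp: simplical_degeneracy_def)
  also have "\<dots> = (\<Sum>j\<le>p. if j \<le> i then x j else 0) + (\<Sum>j\<le>p. if i \<le> j then x (Suc j) else 0)"
    by (rule sum.distrib)
  also have "(\<Sum>j\<le>p. if j \<le> i then x j else 0) = (\<Sum>j\<in>{..i}. x j)"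
    using assms(2) by (intro sum.mono_neutral_cong_right) auto
  also have "(\<Sum>j\<le>p. if i \<le> j then x (Suc j) else 0) = (\<Sum>j\<in>{i..p}. x (Suc j))"
    by (intro sum.mono_neutral_cong_right) auto
  also have "\<dots> = (\<Sum>j\<in>{Suc i..Suc p}. x j)"
    by (simp only: sum.shift_bounds_cl_Suc_ivl)
  also have "(\<Sum>j\<in>{..i}. x j) + \<dots> = (\<Sum>j\<in>{..i} \<union> {Suc i..Suc p}. x j)"
    by (rule sum.union_disjoint[symmetric]) auto
  also have "{..i} \<union> {Suc i..Suc p} = {..Suc p}"
    using assms(2) by auto
  finally have sum1: "(\<Sum>j\<le>p. simplical_degeneracy i x j) = 1"
    using x by simp
  have nonneg: "0 \<le> simplical_degeneracy i x j" for j
    using x(1) by (auto simp: simplical_degeneracy_def)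
  have zero: "simplical_degeneracy i x j = 0" if "p < j" for j
    using x(2) that assms(2) by (auto simp: simplical_degeneracy_def)
  have "simplical_degeneracy i x j \<le> 1" for j
    using zero[of j] member_le_sum[of j "{..p}" "simplical_degeneracy i x"] nonneg sum1
    by (cases "j \<le> p") auto
  with sum1 nonneg zero show ?thesis
    by (auto simp: standard_simplex_def)
qed

lemma partial_sum_standard_simplex:
  assumes "x \<in> standard_simplex p" "I \<subseteq> {..p}"
  shows "(\<Sum>l\<in>I. x l) \<in> {0..1}"
  using assms sum_mono2[of "{..p}" I x] by (auto simp: standard_simplex_def intro: sum_nonneg)

text \<open>Vertices up to \<open>i\<close> of prism simplex \<open>i\<close> lie at height 0 over
  the vertex with the same index, the later ones at height 1 over the preceding index. Deleting
  \<open>j < i\<close> on the lower level leaves a prism simplex over face \<open>j\<close>, and the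
  vertex at which the level changes moves down to \<open>i - 1\<close>.\<close>

lemma prism_simplex_face_less:
  assumes "i \<le> Suc p" "j < i"
  shows "singular_face (Suc (Suc p)) j (prism_simplex (Suc p) i H \<sigma>)
       = prism_simplex p (i - 1) H (singular_face (Suc p) j \<sigma>)"
proof (rule ext)
  fix x :: "nat \<Rightarrow> real"
  have "simplical_degeneracy i (simplical_face j x) = simplical_face j (simplical_degeneracy (i - 1) x)"
    using assms by (auto simp: simplical_degeneracy_def simplical_face_def fun_eq_iff)
  moreover have "(\<Sum>l\<in>{i<..Suc (Suc p)}. simplical_face j x l) = (\<Sum>l\<in>{i - 1<..Suc p}. x l)"
    using assms by (intro sum.reindex_bij_witness[where i = Suc and j = "\<lambda>l. l - 1"])
      (auto simp: simplical_face_def)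
  moreover have "simplical_face j x \<in> standard_simplex (Suc (Suc p))"
       "simplical_degeneracy (i - 1) x \<in> standard_simplex p"
    if "x \<in> standard_simplex (Suc p)"
    using that assms
    by (auto intro!: simplical_face_in_standard_simplex simplical_degeneracy_in_standard_simplex)
  ultimately show "singular_face (Suc (Suc p)) j (prism_simplex (Suc p) i H \<sigma>) x
       = prism_simplex p (i - 1) H (singular_face (Suc p) j \<sigma>) x"
    by (simp add: singular_face_def prism_simplex_def)
qed

text \<open>On the upper level vertex \<open>j\<close> lies over vertex \<open>j - 1\<close>, which
  explains the shift of the face index; the level still changes at \<open>i\<close>.\<close>

lemma prism_simplex_face_greater:
  assumes "Suc i < j" "j \<le> Suc (Suc p)"
  shows "singular_face (Suc (Suc p)) j (prism_simplex (Suc p) i H \<sigma>)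
       = prism_simplex p i H (singular_face (Suc p) (j - 1) \<sigma>)"
proof (rule ext)
  fix x :: "nat \<Rightarrow> real"
  have "simplical_degeneracy i (simplical_face j x) = simplical_face (j - 1) (simplical_degeneracy i x)"
    using assms by (auto simp: simplical_degeneracy_def simplical_face_def fun_eq_iff)
  moreover have "(\<Sum>l\<in>{i<..Suc (Suc p)}. simplical_face j x l) = (\<Sum>l\<in>{i<..Suc p}. x l)"
  proof -
    \<comment> \<open>The inserted coordinate \<open>j\<close> is zero; it is dropped first, and the
      reindexing then skips the gap.\<close>
    have "(\<Sum>l\<in>{i<..Suc (Suc p)}. simplical_face j x l) = (\<Sum>l\<in>{i<..Suc (Suc p)} - {j}. simplical_face j x l)"
      using assms by (intro sum.mono_neutral_right) (auto simp: simplical_face_def)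
    also have "\<dots> = (\<Sum>l\<in>{i<..Suc p}. x l)"
      using assms
      by (intro sum.reindex_bij_witness[where i = "\<lambda>l. if l < j then l else Suc l" and j = "\<lambda>l. if l < j then l else l - 1"])
        (auto simp: simplical_face_def split: if_splits)
    finally show ?thesis .
  qed
  moreover have "simplical_face j x \<in> standard_simplex (Suc (Suc p))"
       "simplical_degeneracy i x \<in> standard_simplex p"
    if "x \<in> standard_simplex (Suc p)"
    using that assms
    by (auto intro!: simplical_face_in_standard_simplex simplical_degeneracy_in_standard_simplex)
  ultimately show "singular_face (Suc (Suc p)) j (prism_simplex (Suc p) i H \<sigma>) x
       = prism_simplex p i H (singular_face (Suc p) (j - 1) \<sigma>) x"
    by (simp add: singular_face_def prism_simplex_def)
qed

text \<open>Vertices \<open>i\<close> and \<open>Suc i\<close> lie over the same vertex, so without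
  one of them the degeneracy becomes the identity and a section remains. The coordinate of that
  vertex counts for the height here, because the survivor is on the upper level.\<close>

lemma prism_simplex_face_same:
  assumes "i \<le> p"
  shows "singular_face (Suc p) i (prism_simplex p i H \<sigma>) = prism_section p i H \<sigma>"
proof (rule ext)
  fix x :: "nat \<Rightarrow> real"
  have "simplical_degeneracy i (simplical_face i x) = x"
    by (auto simp: simplical_degeneracy_def simplical_face_def fun_eq_iff)
  moreover have "(\<Sum>l\<in>{i<..Suc p}. simplical_face i x l) = (\<Sum>l\<in>{i..p}. x l)"
    by (intro sum.reindex_bij_witness[where i = Suc and j = "\<lambda>l. l - 1"])
      (auto simp: simplical_face_def)
  moreover have "simplical_face i x \<in> standard_simplex (Suc p)"
    if "x \<in> standard_simplex p"
    using that assms by (auto intro!: simplical_face_in_standard_simplex)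
  ultimately show "singular_face (Suc p) i (prism_simplex p i H \<sigma>) x = prism_section p i H \<sigma> x"
    by (simp add: singular_face_def prism_simplex_def prism_section_def)
qed

text \<open>Now the survivor is on the lower level, so the section has index \<open>Suc i\<close>.
  If \<open>Suc i \<le> p\<close>, the same section is the face \<open>Suc i\<close> of prism
  simplex \<open>Suc i\<close>, which is how neighbouring inner faces cancel.\<close>

lemma prism_simplex_face_Suc:
  assumes "i \<le> p"
  shows "singular_face (Suc p) (Suc i) (prism_simplex p i H \<sigma>) = prism_section p (Suc i) H \<sigma>"
proof (rule ext)
  fix x :: "nat \<Rightarrow> real"
  have "simplical_degeneracy i (simplical_face (Suc i) x) = x"
    by (auto simp: simplical_degeneracy_def simplical_face_def fun_eq_iff)
  moreover have "(\<Sum>l\<in>{i<..Suc p}. simplical_face (Suc i) x l) = (\<Sum>l\<in>{Suc i..p}. x l)"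
  proof -
    have "(\<Sum>l\<in>{i<..Suc p}. simplical_face (Suc i) x l) = (\<Sum>l\<in>{Suc i<..Suc p}. simplical_face (Suc i) x l)"
      by (intro sum.mono_neutral_right) (auto simp: simplical_face_def)
    also have "\<dots> = (\<Sum>l\<in>{Suc i..p}. x l)"
      by (intro sum.reindex_bij_witness[where i = Suc and j = "\<lambda>l. l - 1"])
        (auto simp: simplical_face_def)
    finally show ?thesis .
  qed
  moreover have "simplical_face (Suc i) x \<in> standard_simplex (Suc p)"
    if "x \<in> standard_simplex p"
    using that assms by (auto intro!: simplical_face_in_standard_simplex)
  ultimately show "singular_face (Suc p) (Suc i) (prism_simplex p i H \<sigma>) x = prism_section p (Suc i) H \<sigma> x"
    by (simp add: singular_face_def prism_simplex_def prism_section_def)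
qed

lemma prism_section_0:
  "prism_section p 0 H \<sigma> = simplex_map p (\<lambda>y. H (1, y)) \<sigma>"
  by (auto simp: prism_section_def simplex_map_def standard_simplex_def fun_eq_iff restrict_def
      simp flip: atMost_atLeast0)

lemma prism_section_Suc:
  "prism_section p (Suc p) H \<sigma> = simplex_map p (\<lambda>y. H (0, y)) \<sigma>"
  by (auto simp: prism_section_def simplex_map_def)

lemma sum_telescope_bit_mapping:
  "(\<Sum>i\<le>p. f i + f (Suc i)) = f 0 + (f (Suc p) :: 't \<Rightarrow>\<^sub>0 bit)"
  by (induction p) (simp_all add: add.assoc)

text \<open>The faces of all prism simplices fall into side faces, which form the prism over the
  boundary of \<open>\<sigma>\<close>, and sections, which telescope to the two ends.\<close>

lemma boundary_prism_simplex_sum: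
  "(\<Sum>i\<le>p. face_sum (Suc p) (prism_simplex p i H \<sigma>)) =
     Poly_Mapping.single (simplex_map p (\<lambda>y. H (1, y)) \<sigma>) 1
   + Poly_Mapping.single (simplex_map p (\<lambda>y. H (0, y)) \<sigma>) 1
   + (if p = 0 then 0 else prism (p - 1) H (face_sum p \<sigma>))"
proof -
  let ?f = "\<lambda>(i,j). Poly_Mapping.single (singular_face (Suc p) j (prism_simplex p i H \<sigma>)) (1::bit)"
  \<comment> \<open>\<open>A\<close> and \<open>B\<close> index the side faces opposite a vertex on
    the lower and on the upper level, \<open>C\<close> and \<open>D\<close> the two faces of each
    simplex that are sections.\<close>
  define A where "A = {(i,j). i \<le> p \<and> j < i}"
  define B where "B = {(i,j). Suc i < j \<and> j \<le> Suc p}"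
  define C where "C = (\<lambda>i. (i,i)) ` {..p}"
  define D where "D = (\<lambda>i. (i,Suc i)) ` {..p}"
  have AD: "{..p} \<times> {..Suc p} = (A \<union> B) \<union> (C \<union> D)"
    by (auto simp: A_def B_def C_def D_def image_iff)
  then have fin: "finite A" "finite B" "finite C" "finite D"
    by (metis finite_Un finite_SigmaI finite_atMost)+
  have disj: "(A \<union> B) \<inter> (C \<union> D) = {}" "A \<inter> B = {}" "C \<inter> D = {}"
    by (auto simp: A_def B_def C_def D_def)
  have "(\<Sum>i\<le>p. face_sum (Suc p) (prism_simplex p i H \<sigma>)) = sum ?f ({..p} \<times> {..Suc p})"
    unfolding face_sum_def sum.cartesian_product ..
  also have "\<dots> = (sum ?f A + sum ?f B) + (sum ?f C + sum ?f D)"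
    unfolding AD using fin disj by (simp add: sum.union_disjoint)
  also have "sum ?f C = (\<Sum>i\<le>p. Poly_Mapping.single (prism_section p i H \<sigma>) 1)"
    unfolding C_def by (subst sum.reindex) (auto simp: inj_on_def prism_simplex_face_same)
  also have "sum ?f D = (\<Sum>i\<le>p. Poly_Mapping.single (prism_section p (Suc i) H \<sigma>) 1)"
    unfolding D_def by (subst sum.reindex) (auto simp: inj_on_def prism_simplex_face_Suc)
  also have "(\<Sum>i\<le>p. Poly_Mapping.single (prism_section p i H \<sigma>) (1::bit))
        + (\<Sum>i\<le>p. Poly_Mapping.single (prism_section p (Suc i) H \<sigma>) 1)
      = Poly_Mapping.single (simplex_map p (\<lambda>y. H (1, y)) \<sigma>) 1
   + Poly_Mapping.single (simplex_map p (\<lambda>y. H (0, y)) \<sigma>) 1"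
    using sum_telescope_bit_mapping[of "\<lambda>i. Poly_Mapping.single (prism_section p i H \<sigma>) 1" p]
    by (simp add: sum.distrib prism_section_0 prism_section_Suc)
  also have "sum ?f A + sum ?f B = (if p = 0 then 0 else prism (p - 1) H (face_sum p \<sigma>))"
  proof (cases p)
    case 0
    then have "A = {}" "B = {}"
      by (auto simp: A_def B_def)
    with 0 show ?thesis
      by simp
  next
    case (Suc q)
    \<comment> \<open>Side faces are indexed anew by the face \<open>j\<close> of
      \<open>\<sigma>\<close> and the number \<open>i\<close> of the simplex in the prism over that
      face.\<close>
    let ?g = "\<lambda>(j,i). Poly_Mapping.single (prism_simplex q i H (singular_face p j \<sigma>)) (1::bit)"
    define A' where "A' = {(j,i). i \<le> q \<and> j \<le> i}"
    define B' where "B' = {(j,i). i < j \<and> j \<le> p}"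
    have "sum ?f A = sum ?g A'"
      by (rule sum.reindex_bij_witness[where i = "\<lambda>(j,i). (Suc i, j)" and j = "\<lambda>(i,j). (j, i - 1)"])
        (auto simp: A_def A'_def Suc prism_simplex_face_less)
    moreover have "sum ?f B = sum ?g B'"
      by (rule sum.reindex_bij_witness[where i = "\<lambda>(j,i). (i, Suc j)" and j = "\<lambda>(i,j). (j - 1, i)"])
        (auto simp: B_def B'_def Suc prism_simplex_face_greater)
    moreover have AB: "{..p} \<times> {..q} = A' \<union> B'" "A' \<inter> B' = {}"
      by (auto simp: A'_def B'_def Suc)
    moreover have "finite A'" "finite B'"
      using AB(1) by (metis finite_Un finite_SigmaI finite_atMost)+
    ultimately have "sum ?f A + sum ?f B = sum ?g ({..p} \<times> {..q})"
      by (simp add: sum.union_disjoint)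
    also have "\<dots> = prism q H (face_sum p \<sigma>)"
      unfolding prism_def face_sum_def zext_sum zext_single sum.cartesian_product ..
    finally show ?thesis
      using Suc by simp
  qed
  finally show ?thesis
    by (simp add: add_ac)
qed

text \<open>The chain homotopy formula. In degree 0 the truncated \<open>p - 1\<close> is harmless,
  since \<open>boundary2 0 c\<close> is 0.\<close>

lemma boundary2_prism:
  "boundary2 (Suc p) (prism p H c) =
     chain_map2 p (\<lambda>y. H (1, y)) c + chain_map2 p (\<lambda>y. H (0, y)) c + prism (p - 1) H (boundary2 p c)"
proof -
  have "boundary2 (Suc p) (prism p H c)
      = zext (\<lambda>\<sigma>. \<Sum>i\<le>p. face_sum (Suc p) (prism_simplex p i H \<sigma>)) c"
    by (simp add: boundary2_Suc prism_def zext_zext zext_sum)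
  moreover have "prism (p - 1) H (boundary2 p c)
      = zext (\<lambda>\<sigma>. if p = 0 then 0 else prism (p - 1) H (face_sum p \<sigma>)) c"
  proof (cases p)
    case 0
    then show ?thesis by (simp add: prism_def zext_def)
  next
    case (Suc q)
    then show ?thesis by (simp add: prism_def zext_zext boundary2_Suc)
  qed
  ultimately show ?thesis
    by (simp add: boundary_prism_simplex_sum zext_fun_add chain_map2_def)
qed

text \<open>Control of \<open>H\<close> on \<open>{0..1} \<times> S\<close> suffices because the
  height is a partial sum of barycentric coordinates and hence between 0 and 1.\<close>

lemma prism_chains2:
  fixes H :: "real \<times> 'a::topological_space \<Rightarrow> 'b::topological_space"
  assumes H: "continuous_on ({0..1} \<times> S) H" "H ` ({0..1} \<times> S) \<subseteq> T"
    and c: "c \<in> chains2 p (top_of_set S)"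
  shows "prism p H c \<in> chains2 (Suc p) (top_of_set T)"
proof -
  have "singular_simplex (Suc p) (top_of_set T) (prism_simplex p i H \<sigma>)"
    if "singular_simplex p (top_of_set S) \<sigma>" "i \<le> p" for i \<sigma>
  proof -
    let ?D = "subtopology (powertop_real UNIV) (standard_simplex (Suc p))"
    have s: "continuous_map ?D (subtopology (powertop_real UNIV) (standard_simplex p)) (simplical_degeneracy i)"
      using simplical_degeneracy_in_standard_simplex that(2)
      by (auto simp: continuous_map_in_subtopology continuous_map_componentwise simplical_degeneracy_def
          intro!: continuous_map_from_subtopology continuous_map_add continuous_map_product_projection)
    have "continuous_map (subtopology (powertop_real UNIV) (standard_simplex p)) (top_of_set S) \<sigma>"
      using that(1) by (simp add: singular_simplex_def)
    from continuous_map_compose[OF s this]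
    have 1: "continuous_map ?D (top_of_set S) (\<lambda>x. \<sigma> (simplical_degeneracy i x))"
      by (simp add: o_def)
    have "continuous_map ?D euclideanreal (\<lambda>x. \<Sum>l\<in>{i<..Suc p}. x l)"
      by (intro continuous_map_sum continuous_map_from_subtopology continuous_map_product_projection) auto
    then have 2: "continuous_map ?D (top_of_set {0..1}) (\<lambda>x. \<Sum>l\<in>{i<..Suc p}. x l)"
      using partial_sum_standard_simplex[of _ "Suc p" "{i<..Suc p}"]
      by (simp add: continuous_map_in_subtopology image_subset_iff Pi_iff subset_iff)
    have 3: "continuous_map ?D (top_of_set ({0..1} \<times> S)) (\<lambda>x. (\<Sum>l\<in>{i<..Suc p}. x l, \<sigma> (simplical_degeneracy i x)))"
      using continuous_map_pairedI[OF 2 1] by simp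
    have "continuous_map (top_of_set ({0..1} \<times> S)) (top_of_set T) H"
      using H by (auto simp: continuous_map_in_subtopology)
    from continuous_map_compose[OF 3 this]
    have "continuous_map ?D (top_of_set T) (prism_simplex p i H \<sigma>)"
      by (rule continuous_map_eq) (simp add: prism_simplex_def)
    then show ?thesis
      by (simp add: singular_simplex_def prism_simplex_def)
  qed
  then show ?thesis
    unfolding prism_def by (intro chains2_zext[OF c] chains2_sum chains2_single) auto
qed

lemma chain_map2_chains2:
  assumes "continuous_on S f" "f ` S \<subseteq> T" "c \<in> chains2 p (top_of_set S)"
  shows "chain_map2 p f c \<in> chains2 p (top_of_set T)"
proof -
  have "continuous_map (top_of_set S) (top_of_set T) f"
    using assms by (auto simp: continuous_map_in_subtopology)
  then show ?thesis
    unfolding chain_map2_def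
    by (intro chains2_zext[OF assms(3)] chains2_single) (auto intro: singular_simplex_simplex_map)
qed

lemma chain_map2_ident:
  assumes "\<And>y. y \<in> S \<Longrightarrow> f y = y" "c \<in> chains2 p (top_of_set S)"
  shows "chain_map2 p f c = c"
proof -
  have "simplex_map p f \<sigma> = \<sigma>" if "\<sigma> \<in> Poly_Mapping.keys c" for \<sigma>
  proof -
    have "singular_simplex p (top_of_set S) \<sigma>"
      using that assms(2) by (auto simp: chains2_def)
    then show ?thesis
      using assms(1) simplex_map_id_gen[of p "top_of_set S" \<sigma> f] by auto
  qed
  then have "chain_map2 p f c = zext (\<lambda>\<sigma>. Poly_Mapping.single \<sigma> 1) c"
    unfolding chain_map2_def by (intro zext_cong) simp
  then show ?thesis
    by (simp add: zext_identity)
qed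

lemma boundary2_chain_map2:
  assumes "c \<in> chains2 (Suc p) (top_of_set S)"
  shows "boundary2 (Suc p) (chain_map2 (Suc p) f c) = chain_map2 p f (boundary2 (Suc p) c)"
proof -
  have "face_sum (Suc p) (simplex_map (Suc p) f \<sigma>) =
      zext (\<lambda>\<sigma>. Poly_Mapping.single (simplex_map p f \<sigma>) 1) (face_sum (Suc p) \<sigma>)" for \<sigma>
    unfolding face_sum_def zext_sum zext_single
    by (intro sum.cong) (auto simp: singular_face_def simplex_map_def restrict_def fun_eq_iff
        simplical_face_in_standard_simplex intro!: arg_cong2[where f = Poly_Mapping.single])
  then show ?thesis
    by (simp add: chain_map2_def boundary2_Suc zext_zext)
qed

section \<open>Ranks of maps in homology\<close>

abbreviation cycles2 :: "nat \<Rightarrow> 'a topology \<Rightarrow> 'a chain2 set" where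
  "cycles2 p X \<equiv> carrier (cycle_group2 p X)"

definition class2 :: "nat \<Rightarrow> 'a topology \<Rightarrow> 'a chain2 \<Rightarrow> 'a chain2 set" where
  "class2 p X c = (\<lambda>b. b + c) ` boundaries2 p X"

lemma cycles2_eq: "cycles2 p X = {c \<in> chains2 p X. boundary2 p c = 0}"
  by (simp add: cycle_group2_def)

lemma cycle_group2_simps [simp]:
  "monoid.mult (cycle_group2 p X) = (+)" "one (cycle_group2 p X) = 0"
  by (simp_all add: cycle_group2_def)

lemma comm_group_cycle_group2: "comm_group (cycle_group2 p X)"
proof (rule comm_groupI)
  fix c assume "c \<in> cycles2 p X"
  then show "\<exists>d\<in>cycles2 p X. d \<otimes>\<^bsub>cycle_group2 p X\<^esub> c = \<one>\<^bsub>cycle_group2 p X\<^esub>"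
    by (intro bexI[of _ c]) simp_all
qed (simp_all add: cycles2_eq chains2_add boundary2_add add.assoc add.commute)

lemma boundaries2_0 [simp]: "0 \<in> boundaries2 p X"
  unfolding boundaries2_def by (rule image_eqI[of _ _ 0]) simp_all

lemma boundaries2_add: "b \<in> boundaries2 p X \<Longrightarrow> c \<in> boundaries2 p X \<Longrightarrow> b + c \<in> boundaries2 p X"
  unfolding boundaries2_def by (auto simp flip: boundary2_add intro!: imageI chains2_add)

lemma boundaries2_subset_cycles2: "boundaries2 p X \<subseteq> cycles2 p X"
  by (auto simp: boundaries2_def cycles2_eq boundary2_chains2 boundary2_boundary2)

lemma boundaries2_mono:
  "S \<subseteq> T \<Longrightarrow> boundaries2 p (top_of_set S) \<subseteq> boundaries2 p (top_of_set T)"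
  using chains2_mono unfolding boundaries2_def by (intro image_mono subsetI)

lemma cycles2_mono:
  "S \<subseteq> T \<Longrightarrow> cycles2 p (top_of_set S) \<subseteq> cycles2 p (top_of_set T)"
  using chains2_mono by (auto simp: cycles2_eq)

lemma normal_boundaries2: "boundaries2 p X \<lhd> cycle_group2 p X"
proof -
  interpret comm_group "cycle_group2 p X"
    by (rule comm_group_cycle_group2)
  have "subgroup (boundaries2 p X) (cycle_group2 p X)"
  proof (rule subgroupI)
    fix c assume "c \<in> boundaries2 p X"
    moreover from this have "c \<in> cycles2 p X"
      using boundaries2_subset_cycles2 by blast
    then have "inv\<^bsub>cycle_group2 p X\<^esub> c = c"
      by (intro inv_equality) simp_all
    ultimately show "inv\<^bsub>cycle_group2 p X\<^esub> c \<in> boundaries2 p X"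
      by simp
  next
    show "boundaries2 p X \<noteq> {}"
      using boundaries2_0[of p X] by blast
  qed (use boundaries2_subset_cycles2 in \<open>auto simp: boundaries2_add\<close>)
  then show ?thesis
    by (rule subgroup_imp_normal)
qed

lemma group_homology2: "group (homology2 p X)"
  unfolding homology2_def by (rule normal.factorgroup_is_group[OF normal_boundaries2])

lemma carrier_homology2: "carrier (homology2 p X) = class2 p X ` cycles2 p X"
  by (auto simp: homology2_def carrier_FactGroup class2_def r_coset_def)

lemma class2_add:
  assumes "c \<in> cycles2 p X" "d \<in> cycles2 p X"
  shows "class2 p X c \<otimes>\<^bsub>homology2 p X\<^esub> class2 p X d = class2 p X (c + d)"
proof -
  have *: "boundaries2 p X #>\<^bsub>cycle_group2 p X\<^esub> c = class2 p X c" for c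
    by (auto simp: class2_def r_coset_def)
  show ?thesis
    using normal.rcos_sum[OF normal_boundaries2 assms] by (simp add: homology2_def *)
qed

lemma class2_eq_iff: "class2 p X c = class2 p X d \<longleftrightarrow> c + d \<in> boundaries2 p X"
proof
  assume "class2 p X c = class2 p X d"
  moreover have "c \<in> class2 p X c"
    unfolding class2_def by (rule image_eqI[of _ _ 0]) simp_all
  ultimately obtain b where "b \<in> boundaries2 p X" "c = b + d"
    by (auto simp: class2_def)
  then show "c + d \<in> boundaries2 p X"
    by (simp add: add.assoc)
next
  have *: "class2 p X c \<subseteq> class2 p X d" if "c + d \<in> boundaries2 p X" for c d
  proof
    fix x assume "x \<in> class2 p X c"
    then obtain b where b: "b \<in> boundaries2 p X" "x = b + c"
      by (auto simp: class2_def)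
    show "x \<in> class2 p X d"
      unfolding class2_def
      by (rule image_eqI[of _ _ "b + (c + d)"]) (use b that in \<open>simp_all add: add.assoc boundaries2_add\<close>)
  qed
  assume "c + d \<in> boundaries2 p X"
  then show "class2 p X c = class2 p X d"
    using * by (metis add.commute subset_antisym)
qed

text \<open>Boundaries of the smaller space are boundaries of the larger one, so the set sum absorbs
  them and only the representative survives.\<close>

lemma hom_incl2_class2:
  assumes "S \<subseteq> T"
  shows "hom_incl2 p (top_of_set T) (class2 p (top_of_set S) c) = class2 p (top_of_set T) c"
proof
  show "hom_incl2 p (top_of_set T) (class2 p (top_of_set S) c) \<subseteq> class2 p (top_of_set T) c"
  proof
    fix x assume "x \<in> hom_incl2 p (top_of_set T) (class2 p (top_of_set S) c)"
    then obtain b b' where "b \<in> boundaries2 p (top_of_set T)" "b' \<in> boundaries2 p (top_of_set S)"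
      and x: "x = b + (b' + c)"
      by (auto simp: hom_incl2_def set_mult_def class2_def)
    then have "b + b' \<in> boundaries2 p (top_of_set T)"
      using boundaries2_mono[OF assms] by (intro boundaries2_add) auto
    then show "x \<in> class2 p (top_of_set T) c"
      unfolding class2_def by (rule rev_image_eqI) (simp add: x add.assoc)
  qed
  have "0 + c \<in> class2 p (top_of_set S) c"
    unfolding class2_def by (intro imageI) simp
  then show "class2 p (top_of_set T) c \<subseteq> hom_incl2 p (top_of_set T) (class2 p (top_of_set S) c)"
    by (force simp: hom_incl2_def set_mult_def class2_def)
qed

text \<open>Since inclusion keeps representatives, the rank is expressed by classes in
  \<open>T\<close> of cycles of \<open>S\<close>. Comparing ranks becomes a question about cycles
  and boundaries.\<close>

lemma incl_rank2_eq:
  assumes "S \<subseteq> T"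
  shows "incl_rank2 p (top_of_set S) (top_of_set T) =
    z2_dim ((homology2 p (top_of_set T))\<lparr>carrier := class2 p (top_of_set T) ` cycles2 p (top_of_set S)\<rparr>)"
  using assms by (simp add: incl_rank2_def carrier_homology2 image_image hom_incl2_class2)

lemma group_image_class2:
  assumes "S \<subseteq> T"
  shows "group ((homology2 p (top_of_set T))\<lparr>carrier := class2 p (top_of_set T) ` cycles2 p (top_of_set S)\<rparr>)"
proof -
  have "class2 p (top_of_set T) \<in> hom (cycle_group2 p (top_of_set S)) (homology2 p (top_of_set T))"
    using cycles2_mono[OF assms, of p] by (auto simp: hom_def carrier_homology2 class2_add subset_iff)
  then interpret group_hom "cycle_group2 p (top_of_set S)" "homology2 p (top_of_set T)" "class2 p (top_of_set T)"
    by (simp add: group_hom_def group_hom_axioms_def group_homology2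
        comm_group.axioms(2) comm_group_cycle_group2)
  show ?thesis
    by (rule subgroup.subgroup_is_group[OF img_is_subgroup group_homology2])
qed

lemma generating_set_iso:
  assumes "group G" "group H" "h \<in> iso G H"
    and "\<exists>B. finite B \<and> B \<subseteq> carrier G \<and> generate G B = carrier G \<and> card B = n"
  shows "\<exists>B. finite B \<and> B \<subseteq> carrier H \<and> generate H B = carrier H \<and> card B = n"
proof -
  from assms(4) obtain B
    where B: "finite B" "B \<subseteq> carrier G" "generate G B = carrier G" "card B = n"
    by blast
  have h: "inj_on h (carrier G)" "h ` carrier G = carrier H"
    using assms(3) by (auto simp: iso_def bij_betw_def)
  interpret group_hom G H h
    using assms by (simp add: group_hom_def group_hom_axioms_def iso_def)
  have "generate H (h ` B) = carrier H"
    using generate_img[OF B(2)] B(3) h by simp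
  then show ?thesis
    using B h inj_on_subset[OF h(1) B(2)] by (intro exI[of _ "h ` B"]) (auto simp: card_image)
qed

text \<open>Generating sets are transported both ways, so the predicates under \<open>LEAST\<close>
  agree at every size; the equality holds even if no finite generating set exists.\<close>

lemma z2_dim_iso:
  assumes "group G" "group H" "h \<in> iso G H"
  shows "z2_dim G = z2_dim H"
proof -
  have "inv_into (carrier G) h \<in> iso H G"
    using assms by (simp add: group.iso_set_sym)
  then show ?thesis
    unfolding z2_dim_def
    using generating_set_iso[OF assms] generating_set_iso[OF assms(2,1)]
    by (intro arg_cong[of _ _ Least] ext iffI)
qed

text \<open>Both images lie in the homology of the same \<open>T\<close>, and the hypothesis makes
  them equal as sets.\<close>

lemma incl_rank2_source_cong:
  assumes "S1 \<subseteq> S2" "S2 \<subseteq> T"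
    and "\<And>c. c \<in> cycles2 p (top_of_set S2) \<Longrightarrow>
           \<exists>d \<in> cycles2 p (top_of_set S1). c + d \<in> boundaries2 p (top_of_set T)"
  shows "incl_rank2 p (top_of_set S1) (top_of_set T) = incl_rank2 p (top_of_set S2) (top_of_set T)"
proof -
  have "class2 p (top_of_set T) ` cycles2 p (top_of_set S1) = class2 p (top_of_set T) ` cycles2 p (top_of_set S2)"
  proof
    show "class2 p (top_of_set T) ` cycles2 p (top_of_set S1) \<subseteq> class2 p (top_of_set T) ` cycles2 p (top_of_set S2)"
      using cycles2_mono[OF assms(1)] by (rule image_mono)
    show "class2 p (top_of_set T) ` cycles2 p (top_of_set S2) \<subseteq> class2 p (top_of_set T) ` cycles2 p (top_of_set S1)"
      using assms(3) by (auto simp: image_iff class2_eq_iff)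
  qed
  then show ?thesis
    using assms by (simp add: incl_rank2_eq)
qed

text \<open>The images live in different groups here. Inclusion maps the first onto the second, and
  the hypothesis says that its kernel is trivial.\<close>

lemma incl_rank2_target_cong:
  assumes "S \<subseteq> T1" "T1 \<subseteq> T2"
    and "\<And>c. c \<in> cycles2 p (top_of_set S) \<Longrightarrow> c \<in> boundaries2 p (top_of_set T2) \<Longrightarrow>
           c \<in> boundaries2 p (top_of_set T1)"
  shows "incl_rank2 p (top_of_set S) (top_of_set T1) = incl_rank2 p (top_of_set S) (top_of_set T2)"
proof -
  let ?G = "\<lambda>T. (homology2 p (top_of_set T))\<lparr>carrier := class2 p (top_of_set T) ` cycles2 p (top_of_set S)\<rparr>"
  have ST2: "S \<subseteq> T2"
    using assms by blast
  interpret S: comm_group "cycle_group2 p (top_of_set S)"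
    by (rule comm_group_cycle_group2)
  have add: "c + d \<in> cycles2 p (top_of_set S)"
    if "c \<in> cycles2 p (top_of_set S)" "d \<in> cycles2 p (top_of_set S)" for c d
    using S.m_closed[OF that] by simp
  have "hom_incl2 p (top_of_set T2) \<in> iso (?G T1) (?G T2)"
  proof (rule isoI)
    show "hom_incl2 p (top_of_set T2) \<in> hom (?G T1) (?G T2)"
      using cycles2_mono[OF assms(1), of p] cycles2_mono[OF ST2, of p]
      by (auto simp: hom_def hom_incl2_class2[OF assms(2)] class2_add subset_iff add)
    have "inj_on (hom_incl2 p (top_of_set T2)) (class2 p (top_of_set T1) ` cycles2 p (top_of_set S))"
      using assms(3) add by (auto simp: inj_on_def hom_incl2_class2[OF assms(2)] class2_eq_iff)
    then show "bij_betw (hom_incl2 p (top_of_set T2)) (carrier (?G T1)) (carrier (?G T2))"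
      by (simp add: bij_betw_def image_image hom_incl2_class2[OF assms(2)])
  qed
  then have "z2_dim (?G T1) = z2_dim (?G T2)"
    by (intro z2_dim_iso group_image_class2 assms ST2)
  then show ?thesis
    using assms ST2 by (simp add: incl_rank2_eq)
qed

section \<open>Homotopies that leave ranks unchanged\<close>

lemma boundary2_prism_identity:
  assumes "c \<in> chains2 p (top_of_set S)" "\<And>x. x \<in> S \<Longrightarrow> H (0, x) = x"
  shows "boundary2 (Suc p) (prism p H c) = chain_map2 p (\<lambda>y. H (1, y)) c + c + prism (p - 1) H (boundary2 p c)"
  using chain_map2_ident[OF _ assms(1), of "\<lambda>y. H (0, y)"] assms(2) by (simp add: boundary2_prism)

lemma continuous_on_homotopy_end:
  assumes "continuous_on ({0..1::real} \<times> S) H"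
  shows "continuous_on S (\<lambda>y. H (1, y))"
  by (rule continuous_on_compose2[OF assms]) (auto intro: continuous_on_Pair continuous_on_const continuous_on_id)

text \<open>The end map turns a cycle of \<open>S2\<close> into a cycle of \<open>S1\<close>, and
  the prism between the two stays in \<open>S2\<close>, hence in \<open>T\<close>.\<close>

lemma incl_rank2_homotopy_source:
  fixes H :: "real \<times> 'a::topological_space \<Rightarrow> 'a"
  assumes S: "S1 \<subseteq> S2" "S2 \<subseteq> T"
    and H: "continuous_on ({0..1} \<times> S2) H" "\<And>x. x \<in> S2 \<Longrightarrow> H (0, x) = x"
    and into: "H ` ({0..1} \<times> S2) \<subseteq> S2" "\<And>x. x \<in> S2 \<Longrightarrow> H (1, x) \<in> S1"
  shows "incl_rank2 p (top_of_set S1) (top_of_set T) = incl_rank2 p (top_of_set S2) (top_of_set T)"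
proof (rule incl_rank2_source_cong[OF S])
  fix c assume "c \<in> cycles2 p (top_of_set S2)"
  then have c: "c \<in> chains2 p (top_of_set S2)" "boundary2 p c = 0"
    by (auto simp: cycles2_eq)
  let ?h = "chain_map2 p (\<lambda>y. H (1, y)) c"
  have "boundary2 p ?h = 0"
  proof (cases p)
    case (Suc q)
    then show ?thesis
      using c boundary2_chain_map2[of c q S2] by (simp add: chain_map2_def)
  qed simp
  moreover have "?h \<in> chains2 p (top_of_set S1)"
    using into(2) by (intro chain_map2_chains2[OF continuous_on_homotopy_end[OF H(1)] _ c(1)]) auto
  ultimately have "?h \<in> cycles2 p (top_of_set S1)"
    by (simp add: cycles2_eq)
  moreover have "c + ?h = boundary2 (Suc p) (prism p H c)"
    using boundary2_prism_identity[OF c(1) H(2)] c(2) by (simp add: prism_def add.commute)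
  moreover have "prism p H c \<in> chains2 (Suc p) (top_of_set T)"
    using S(2) into(1) by (intro prism_chains2[OF H(1) _ c(1)]) blast
  ultimately show "\<exists>d\<in>cycles2 p (top_of_set S1). c + d \<in> boundaries2 p (top_of_set T)"
    unfolding boundaries2_def by (intro bexI[of _ ?h]) simp_all
qed

text \<open>If c is the boundary of a chain d in \<open>T2\<close>, then the end map carries d into
  \<open>T1\<close> and the boundary of its image is the image of c. The prism over c, which stays
  in \<open>S\<close>, corrects this image back to c. Hence intermediate times have to be controlled
  on \<open>S\<close> only.\<close>

lemma incl_rank2_homotopy_target:
  fixes H :: "real \<times> 'a::topological_space \<Rightarrow> 'a"
  assumes T: "S \<subseteq> T1" "T1 \<subseteq> T2"
    and H: "continuous_on ({0..1} \<times> T2) H" "\<And>x. x \<in> T2 \<Longrightarrow> H (0, x) = x"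
    and into: "H ` ({0..1} \<times> S) \<subseteq> S" "\<And>x. x \<in> T2 \<Longrightarrow> H (1, x) \<in> T1"
  shows "incl_rank2 p (top_of_set S) (top_of_set T1) = incl_rank2 p (top_of_set S) (top_of_set T2)"
proof (rule incl_rank2_target_cong[OF T])
  fix c assume "c \<in> cycles2 p (top_of_set S)" "c \<in> boundaries2 p (top_of_set T2)"
  then obtain d where c: "c \<in> chains2 p (top_of_set S)"
    and d: "d \<in> chains2 (Suc p) (top_of_set T2)" "c = boundary2 (Suc p) d"
    by (auto simp: boundaries2_def cycles2_eq)
  let ?h = "\<lambda>y. H (1, y)"
  have ST2: "S \<subseteq> T2"
    using T by blast
  have contS: "continuous_on ({0..1} \<times> S) H"
    by (rule continuous_on_subset[OF H(1)]) (use ST2 in blast)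
  have "boundary2 p c = 0"
    by (simp add: d(2) boundary2_boundary2)
  then have "boundary2 (Suc p) (prism p H c) = chain_map2 p ?h c + c"
    using boundary2_prism_identity[OF c, of H] H(2) ST2 by (simp add: prism_def subset_iff)
  moreover have "chain_map2 p ?h c = boundary2 (Suc p) (chain_map2 (Suc p) ?h d)"
    unfolding d(2) by (rule boundary2_chain_map2[OF d(1), symmetric])
  ultimately have "c = boundary2 (Suc p) (chain_map2 (Suc p) ?h d + prism p H c)"
    by (simp add: boundary2_add)
  moreover have "chain_map2 (Suc p) ?h d + prism p H c \<in> chains2 (Suc p) (top_of_set T1)"
  proof (rule chains2_add)
    show "chain_map2 (Suc p) ?h d \<in> chains2 (Suc p) (top_of_set T1)"
      using into(2) by (intro chain_map2_chains2[OF continuous_on_homotopy_end[OF H(1)] _ d(1)]) auto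
    show "prism p H c \<in> chains2 (Suc p) (top_of_set T1)"
      using into(1) T(1) by (intro prism_chains2[OF contS _ c]) blast
  qed
  ultimately show "c \<in> boundaries2 p (top_of_set T1)"
    unfolding boundaries2_def by (rule image_eqI)
qed

section \<open>Tangent spaces and gradients of submanifolds\<close>

text \<open>\<open>frechet_derivative\<close> is a choice operator, so the derivative predicates are
  shown to agree; the equality then holds also where no derivative exists.\<close>

lemma frechet_derivative_cong_open:
  assumes "open U" "x \<in> U" "\<And>y. y \<in> U \<Longrightarrow> f y = g y"
  shows "frechet_derivative f (at x) = frechet_derivative g (at x)"
proof -
  have "(f has_derivative f') (at x) \<longleftrightarrow> (g has_derivative f') (at x)" for f'
    using has_derivative_transform_within_open[OF _ assms(1,2), of f f' UNIV g]
      has_derivative_transform_within_open[OF _ assms(1,2), of g f' UNIV f] assms(3)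
    by metis
  then show ?thesis
    by (simp add: frechet_derivative_def)
qed

lemma differentiable_cong_open:
  assumes "open U" "x \<in> U" "\<And>y. y \<in> U \<Longrightarrow> f y = g y" "f differentiable (at x)"
  shows "g differentiable (at x)"
  using assms(3,4) has_derivative_transform_within_open[OF _ assms(1,2), of f _ UNIV g]
  unfolding differentiable_def by metis

lemma times_differentiable_on_cong_open:
  assumes "open U" "\<And>x. x \<in> U \<Longrightarrow> f x = g x" "times_differentiable_on n f U"
  shows "times_differentiable_on n g U"
  using assms(2,3)
proof (induction n arbitrary: f g)
  case 0
  then show ?case
    by (simp cong: continuous_on_cong)
next
  case (Suc n)
  have "times_differentiable_on n (\<lambda>x. frechet_derivative g (at x) v) U" for v
  proof (rule Suc.IH)
    show "times_differentiable_on n (\<lambda>x. frechet_derivative f (at x) v) U"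
      using Suc.prems by simp
    show "frechet_derivative f (at x) v = frechet_derivative g (at x) v" if "x \<in> U" for x
      using frechet_derivative_cong_open[OF assms(1) that, of f g] Suc.prems(1) by simp
  qed
  moreover have "g differentiable (at x)" if "x \<in> U" for x
    using differentiable_cong_open[OF assms(1) that, of f g] Suc.prems that by auto
  ultimately show ?case
    by simp
qed

text \<open>The inner map is affine, so the derivative along the line is a directional derivative of
  \<open>g\<close> read along the same line, and the induction closes without a general chain rule
  of higher order. This makes the curves obtained from lines in a chart smooth.\<close>

lemma times_differentiable_on_line:
  fixes g :: "'a::euclidean_space \<Rightarrow> 'b::real_normed_vector"
  assumes "open I" "\<And>t. t \<in> I \<Longrightarrow> y + t *\<^sub>R v \<in> U" "times_differentiable_on n g U"
  shows "times_differentiable_on n (\<lambda>t::real. g (y + t *\<^sub>R v)) I"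
  using assms(3)
proof (induction n arbitrary: g)
  case 0
  have "continuous_on I (\<lambda>t. y + t *\<^sub>R v)"
    by (intro continuous_intros)
  then show ?case
    using 0 assms(2) by (auto intro: continuous_on_compose2)
next
  case (Suc n)
  have der: "((\<lambda>t. g (y + t *\<^sub>R v)) has_derivative (\<lambda>s. frechet_derivative g (at (y + t *\<^sub>R v)) (s *\<^sub>R v))) (at t)"
    if "t \<in> I" for t
  proof -
    have "(g has_derivative frechet_derivative g (at (y + t *\<^sub>R v))) (at (y + t *\<^sub>R v))"
      using Suc.prems assms(2)[OF that] by (simp flip: frechet_derivative_works)
    moreover have "((\<lambda>t. y + t *\<^sub>R v) has_derivative (\<lambda>s. s *\<^sub>R v)) (at t)"
      by (auto intro!: derivative_eq_intros)
    ultimately show ?thesis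
      using has_derivative_compose by blast
  qed
  have "times_differentiable_on n (\<lambda>t. frechet_derivative (\<lambda>t. g (y + t *\<^sub>R v)) (at t) s) I" for s
  proof (rule times_differentiable_on_cong_open[OF assms(1)])
    show "times_differentiable_on n (\<lambda>t. frechet_derivative g (at (y + t *\<^sub>R v)) (s *\<^sub>R v)) I"
      using Suc.IH[of "\<lambda>x. frechet_derivative g (at x) (s *\<^sub>R v)"] Suc.prems by simp
    show "frechet_derivative g (at (y + t *\<^sub>R v)) (s *\<^sub>R v)
        = frechet_derivative (\<lambda>t. g (y + t *\<^sub>R v)) (at t) s" if "t \<in> I" for t
      using frechet_derivative_at[OF der[OF that]] by (simp add: fun_eq_iff)
  qed
  then show ?case
    using der by (auto simp: differentiable_def)
qed

text \<open>Continuity is required for each fixed direction; in finite dimension this amounts to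
  continuity of the derivative as a linear map.\<close>

definition C1_on :: "'a::euclidean_space set \<Rightarrow> ('a \<Rightarrow> 'b::real_normed_vector) \<Rightarrow> bool" where
  "C1_on U f \<longleftrightarrow> (\<forall>x\<in>U. f differentiable (at x)) \<and>
     (\<forall>v. continuous_on U (\<lambda>x. frechet_derivative f (at x) v))"

lemma times_differentiable_on_imp_C1_on:
  assumes "\<And>n. times_differentiable_on n f U"
  shows "C1_on U f"
  using assms[of "Suc 0"] by (simp add: C1_on_def)

lemma C1_on_has_derivative:
  "C1_on U f \<Longrightarrow> x \<in> U \<Longrightarrow> (f has_derivative frechet_derivative f (at x)) (at x)"
  by (simp add: C1_on_def flip: frechet_derivative_works)

lemma C1_on_subset: "C1_on U f \<Longrightarrow> U' \<subseteq> U \<Longrightarrow> C1_on U' f"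
  by (auto simp: C1_on_def intro: continuous_on_subset)

lemma C1_on_continuous_on: "C1_on U f \<Longrightarrow> continuous_on U f"
  by (simp add: C1_on_def continuous_at_imp_continuous_on differentiable_imp_continuous_within)

lemma C1_on_bounded_linear:
  assumes "open U" "C1_on U f" "bounded_linear l"
  shows "C1_on U (\<lambda>x. l (f x))"
proof -
  have der: "((\<lambda>x. l (f x)) has_derivative (\<lambda>v. l (frechet_derivative f (at x) v))) (at x)"
    if "x \<in> U" for x
    by (rule bounded_linear.has_derivative[OF assms(3) C1_on_has_derivative[OF assms(2) that]])
  have "continuous_on U (\<lambda>x. frechet_derivative (\<lambda>x. l (f x)) (at x) v)" for v
  proof -
    have "continuous_on U (\<lambda>x. l (frechet_derivative f (at x) v))"
      using assms(2) by (intro bounded_linear.continuous_on[OF assms(3)]) (simp add: C1_on_def)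
    then show ?thesis
      by (rule continuous_on_eq) (simp add: frechet_derivative_at[OF der, symmetric])
  qed
  then show ?thesis
    using der by (auto simp: C1_on_def differentiable_def)
qed

lemma C1_on_compose:
  fixes f :: "'a::euclidean_space \<Rightarrow> 'b::euclidean_space" and g :: "'b \<Rightarrow> 'c::real_normed_vector"
  assumes "C1_on U f" "C1_on W g" "f ` U \<subseteq> W"
  shows "C1_on U (\<lambda>x. g (f x))"
    and "\<And>x. x \<in> U \<Longrightarrow> frechet_derivative (\<lambda>x. g (f x)) (at x) v
           = frechet_derivative g (at (f x)) (frechet_derivative f (at x) v)"
proof -
  have der: "((\<lambda>x. g (f x)) has_derivative (\<lambda>v. frechet_derivative g (at (f x)) (frechet_derivative f (at x) v))) (at x)"
    if "x \<in> U" for x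
    by (rule has_derivative_compose[OF C1_on_has_derivative[OF assms(1) that]])
      (use C1_on_has_derivative[OF assms(2)] assms(3) that in blast)
  then show eq: "frechet_derivative (\<lambda>x. g (f x)) (at x) v
           = frechet_derivative g (at (f x)) (frechet_derivative f (at x) v)" if "x \<in> U" for x v
    using frechet_derivative_at[OF der[OF that]] by (simp add: fun_eq_iff)
  \<comment> \<open>The direction fed into the derivative of \<open>g\<close> varies with the point,
    while \<open>C1_on\<close> gives continuity for fixed directions; expanding the direction in the
    basis bridges this.\<close>
  have "continuous_on U (\<lambda>x. frechet_derivative (\<lambda>x. g (f x)) (at x) v)" for v
  proof (rule continuous_on_eq)
    have "continuous_on U (\<lambda>x. frechet_derivative g (at (f x)) b)" for b
      by (rule continuous_on_compose2[of W "\<lambda>x. frechet_derivative g (at x) b"])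
        (use assms C1_on_continuous_on in \<open>auto simp: C1_on_def\<close>)
    moreover have "continuous_on U (\<lambda>x. frechet_derivative f (at x) v)"
      using assms(1) by (simp add: C1_on_def)
    ultimately show "continuous_on U (\<lambda>x. \<Sum>b\<in>Basis. (frechet_derivative f (at x) v \<bullet> b) *\<^sub>R frechet_derivative g (at (f x)) b)"
      by (intro continuous_intros)
    show "(\<Sum>b\<in>Basis. (frechet_derivative f (at x) v \<bullet> b) *\<^sub>R frechet_derivative g (at (f x)) b)
        = frechet_derivative (\<lambda>x. g (f x)) (at x) v" if "x \<in> U" for x
    proof -
      have "linear (frechet_derivative g (at (f x)))"
        using C1_on_has_derivative[OF assms(2)] assms(3) that has_derivative_linear by blast
      then have "(\<Sum>b\<in>Basis. (frechet_derivative f (at x) v \<bullet> b) *\<^sub>R frechet_derivative g (at (f x)) b)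
        = frechet_derivative g (at (f x)) (\<Sum>b\<in>Basis. (frechet_derivative f (at x) v \<bullet> b) *\<^sub>R b)"
        by (simp add: linear_sum linear_scale)
      then show ?thesis
        by (simp add: euclidean_representation eq[OF that])
    qed
  qed
  then show "C1_on U (\<lambda>x. g (f x))"
    using der by (auto simp: C1_on_def differentiable_def)
qed

lemma C1_on_cong_open:
  assumes "open U" "\<And>x. x \<in> U \<Longrightarrow> f x = g x" "C1_on U f"
  shows "C1_on U g"
  using times_differentiable_on_cong_open[OF assms(1,2), where n = "Suc 0"] assms(3) by (simp add: C1_on_def)

lemma smooth_onE:
  assumes "smooth_on S f" "x \<in> S"
  obtains U g where "open U" "x \<in> U" "\<forall>n. times_differentiable_on n g U" "\<forall>y\<in>S \<inter> U. f y = g y"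
  using bspec[OF assms(1)[unfolded smooth_on_def] assms(2)] by (elim exE conjE)

text \<open>On an open set a local extension coincides with \<open>f\<close> in a full
  neighbourhood, so \<open>f\<close> inherits its derivatives.\<close>

lemma smooth_on_open_imp_C1_on:
  assumes "open U" "smooth_on U f"
  shows "C1_on U f"
proof -
  have "f differentiable (at x) \<and> isCont (\<lambda>x. frechet_derivative f (at x) v) x" if x: "x \<in> U" for x v
  proof (rule smooth_onE[OF assms(2) x])
    fix N g
    assume N: "open N" "x \<in> N" "\<forall>n. times_differentiable_on n g N" "\<forall>y\<in>U \<inter> N. f y = g y"
    have UN: "open (U \<inter> N)" "x \<in> U \<inter> N"
      using assms(1) N(1,2) x by auto
    have "C1_on (U \<inter> N) g"
      by (rule C1_on_subset[OF times_differentiable_on_imp_C1_on[OF spec[OF N(3)]] Int_lower2])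
    then have C1: "C1_on (U \<inter> N) f"
      by (rule C1_on_cong_open[OF UN(1), rotated]) (rule bspec[OF N(4), symmetric])
    then have "continuous_on (U \<inter> N) (\<lambda>x. frechet_derivative f (at x) v)"
      by (simp add: C1_on_def)
    with UN have "isCont (\<lambda>x. frechet_derivative f (at x) v) x"
      by (simp add: continuous_on_eq_continuous_at)
    moreover have "f differentiable (at x)"
      using C1 UN(2) by (simp add: C1_on_def)
    ultimately show ?thesis
      by simp
  qed
  then show ?thesis
    by (simp add: C1_on_def continuous_at_imp_continuous_on)
qed

text \<open>\<open>g\<close> is a local ambient extension of \<open>f\<close>; the values of
  \<open>f\<close> off M, which smoothness on M does not control, do not enter.\<close>

definition C1_at :: "'a::euclidean_space set \<Rightarrow> ('a \<Rightarrow> real) \<Rightarrow> ('a \<Rightarrow> real) \<Rightarrow> 'a \<Rightarrow> bool" where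
  "C1_at M f g x \<longleftrightarrow> (\<exists>W. open W \<and> x \<in> W \<and> C1_on W g \<and> (\<forall>y\<in>M \<inter> W. f y = g y))"

lemma smooth_on_components_C1_at:
  fixes \<phi> :: "'a::euclidean_space \<Rightarrow> real \<times> real"
  assumes "smooth_on M \<phi>" "x \<in> M"
  shows "\<exists>g. C1_at M (fst \<circ> \<phi>) g x" "\<exists>g. C1_at M (snd \<circ> \<phi>) g x"
proof -
  obtain W g where W: "open W" "x \<in> W"
    "\<forall>n. times_differentiable_on n g W" "\<forall>y\<in>M \<inter> W. \<phi> y = g y"
    by (rule smooth_onE[OF assms])
  have "C1_on W g"
    by (rule times_differentiable_on_imp_C1_on[OF spec[OF W(3)]])
  then have C1: "C1_on W (\<lambda>x. fst (g x))" "C1_on W (\<lambda>x. snd (g x))"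
    using C1_on_bounded_linear[OF W(1) _ bounded_linear_fst] C1_on_bounded_linear[OF W(1) _ bounded_linear_snd]
    by blast+
  then have "C1_at M (fst \<circ> \<phi>) (\<lambda>x. fst (g x)) x \<and> C1_at M (snd \<circ> \<phi>) (\<lambda>x. snd (g x)) x"
    unfolding C1_at_def using W(1,2,4) by (intro conjI exI[of _ W]) simp_all
  then show "\<exists>g. C1_at M (fst \<circ> \<phi>) g x" "\<exists>g. C1_at M (snd \<circ> \<phi>) g x"
    by blast+
qed

text \<open>The inverse has a name of its own because \<open>k\<close> restricted to
  \<open>V \<inter> L\<close> parametrises M near x, and its derivative at \<open>h x\<close> maps
  \<open>L\<close> onto the tangent space.\<close>

definition slice_chart ::
    "'a::euclidean_space set \<Rightarrow> 'a \<Rightarrow> 'a set \<Rightarrow> 'a set \<Rightarrow> 'a set \<Rightarrow> ('a \<Rightarrow> 'a) \<Rightarrow> ('a \<Rightarrow> 'a) \<Rightarrow> bool" where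
  "slice_chart M x U V L h k \<longleftrightarrow> x \<in> M \<and> open U \<and> x \<in> U \<and> open V \<and> subspace L \<and>
     bij_betw h U V \<and> k = inv_into U h \<and> smooth_on U h \<and> smooth_on V k \<and> h ` (M \<inter> U) = V \<inter> L"

lemma smooth_submanifold_slice_chart:
  assumes "smooth_submanifold m M" "x \<in> M"
  obtains U V L h k where "slice_chart M x U V L h k"
proof -
  from bspec[OF assms(1)[unfolded smooth_submanifold_def] assms(2)] obtain U V L h
    where "open U \<and> x \<in> U \<and> open V \<and> diffeomorphism U V h \<and>
       subspace (L :: 'a set) \<and> dim L = m \<and> h ` (M \<inter> U) = V \<inter> L"
    by (elim exE)
  then have "slice_chart M x U V L h (inv_into U h)"
    using assms(2) by (simp add: slice_chart_def diffeomorphism_def)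
  then show thesis
    by (rule that)
qed

context
  fixes M U V L :: "'a::euclidean_space set" and x h k
  assumes chart: "slice_chart M x U V L h k"
begin

lemma slice_chart_image: "h ` (M \<inter> U) = V \<inter> L"
  and slice_chart_bij: "bij_betw h U V" "k = inv_into U h"
  using chart unfolding slice_chart_def by blast+

lemma slice_chart_facts:
  "x \<in> M" "open U" "x \<in> U" "open V" "subspace L" "smooth_on V k" "h x \<in> V \<inter> L"
proof -
  show "x \<in> M" "open U" "x \<in> U" "open V" "subspace L" "smooth_on V k"
    using chart unfolding slice_chart_def by blast+
  then show "h x \<in> V \<inter> L"
    unfolding slice_chart_image[symmetric] by (intro imageI IntI)
qed

lemma slice_chart_inverse:
  "y \<in> U \<Longrightarrow> h y \<in> V" "y \<in> U \<Longrightarrow> k (h y) = y" "z \<in> V \<Longrightarrow> k z \<in> U" "z \<in> V \<Longrightarrow> h (k z) = z"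
  using slice_chart_bij(1) unfolding slice_chart_bij(2)
  by (auto simp: bij_betw_inv_into_left bij_betw_inv_into_right bij_betw_apply
      dest: bij_betw_apply[OF bij_betw_inv_into])

lemma slice_chart_slice:
  assumes "y \<in> M" "y \<in> U"
  shows "h y \<in> L"
proof -
  have "h y \<in> h ` (M \<inter> U)"
    using assms by (intro imageI IntI)
  then show ?thesis
    unfolding slice_chart_image by (rule IntD2)
qed

lemma slice_chart_slice_inverse:
  assumes "z \<in> V" "z \<in> L"
  shows "k z \<in> M"
proof -
  have "z \<in> h ` (M \<inter> U)"
    unfolding slice_chart_image using assms by (rule IntI)
  then obtain y where "y \<in> M" "y \<in> U" "z = h y"
    by (elim imageE IntE)
  then show ?thesis
    using slice_chart_inverse(2) by simp
qed

lemma slice_chart_C1: "C1_on U h" "C1_on V k"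
  using chart smooth_on_open_imp_C1_on unfolding slice_chart_def by blast+

text \<open>The curve is the image of the straight line through \<open>h x\<close> in direction
  \<open>l\<close>, which stays in \<open>L\<close> and is therefore sent into M. The local
  extension \<open>g\<close> stands in for \<open>k\<close>, because it is \<open>g\<close> that
  comes with derivatives of all orders.\<close>

lemma slice_chart_curve:
  assumes "l \<in> L"
  shows "\<exists>c. smooth_curve_through M x c (frechet_derivative k (at (h x)) l)"
proof -
  have "h x \<in> V"
    using slice_chart_facts(7) by simp
  then obtain N g where N: "open N" "h x \<in> N"
    and g': "\<forall>n. times_differentiable_on n g N" "\<forall>y\<in>V \<inter> N. k y = g y"
    by (rule smooth_onE[OF slice_chart_facts(6)])
  note g = spec[OF g'(1)] bspec[OF g'(2)]
  let ?c = "\<lambda>t. g (h x + t *\<^sub>R l)"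
  have "open ((\<lambda>t. h x + t *\<^sub>R l) -` (V \<inter> N))"
    using N slice_chart_facts by (intro open_vimage continuous_intros) auto
  moreover have "0 \<in> (\<lambda>t. h x + t *\<^sub>R l) -` (V \<inter> N)"
    using N slice_chart_facts by simp
  ultimately obtain e where e: "e > 0" "ball 0 e \<subseteq> (\<lambda>t. h x + t *\<^sub>R l) -` (V \<inter> N)"
    by (meson openE)
  then have in_VN: "h x + t *\<^sub>R l \<in> V \<inter> N" if "t \<in> {- e<..<e}" for t
    using that by (auto simp: ball_def subset_iff)
  have "smooth_on {- e<..<e} ?c"
    unfolding smooth_on_def
  proof
    fix t assume "t \<in> {- e<..<e}"
    moreover have "times_differentiable_on n ?c {- e<..<e}" for n
      by (rule times_differentiable_on_line[OF _ _ g(1)]) (use in_VN in auto)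
    ultimately show "\<exists>U g'. open U \<and> t \<in> U \<and> (\<forall>n. times_differentiable_on n g' U) \<and> (\<forall>y\<in>{- e<..<e} \<inter> U. ?c y = g' y)"
      by (intro exI[of _ "{- e<..<e}"] exI[of _ ?c]) auto
  qed
  moreover have "?c ` {- e<..<e} \<subseteq> M"
  proof
    fix z assume "z \<in> ?c ` {- e<..<e}"
    then obtain t where t: "t \<in> {- e<..<e}" "z = ?c t"
      by blast
    have "h x + t *\<^sub>R l \<in> L"
      using slice_chart_facts(5,7) assms by (simp add: subspace_add subspace_scale)
    then show "z \<in> M"
      using slice_chart_slice_inverse[of "h x + t *\<^sub>R l"] in_VN[OF t(1)] g(2)[of "h x + t *\<^sub>R l"] t(2) by simp
  qed
  moreover have "?c 0 = x"
    using g(2)[of "h x"] N slice_chart_facts slice_chart_inverse by auto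
  moreover have "(?c has_vector_derivative frechet_derivative k (at (h x)) l) (at 0)"
  proof -
    have "frechet_derivative k (at (h x)) = frechet_derivative g (at (h x))"
      using N slice_chart_facts g(2) by (intro frechet_derivative_cong_open[of "V \<inter> N"]) auto
    moreover have *: "(g has_derivative frechet_derivative g (at (h x))) (at (h x))"
      using g(1)[of "Suc 0"] N by (simp flip: frechet_derivative_works)
    have "((\<lambda>t. h x + t *\<^sub>R l) has_derivative (\<lambda>s. s *\<^sub>R l)) (at 0)"
      by (auto intro!: derivative_eq_intros)
    from has_derivative_compose[OF this, of g "frechet_derivative g (at (h x))"] *
    have "(?c has_derivative (\<lambda>s. frechet_derivative g (at (h x)) (s *\<^sub>R l))) (at 0)"
      by simp
    ultimately show ?thesis
      using has_derivative_linear[OF *] by (simp add: has_vector_derivative_def linear_scale)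
  qed
  ultimately show ?thesis
    unfolding smooth_curve_through_def using e(1) by blast
qed

text \<open>As \<open>k\<close> inverts \<open>h\<close> near x, the derivative of \<open>k\<close>
  recovers v from the image of v under the derivative of \<open>h\<close>; it remains to see that
  this image is in \<open>L\<close>.\<close>

lemma slice_chart_curve_tangent:
  assumes "smooth_curve_through M x c v"
  shows "v \<in> frechet_derivative k (at (h x)) ` L"
proof -
  obtain e where e: "e > 0" "c ` {- e<..<e} \<subseteq> M" and c: "c 0 = x" "(c has_vector_derivative v) (at 0)"
    using assms unfolding smooth_curve_through_def by blast
  let ?Dh = "frechet_derivative h (at x)"
  have Dh: "(h has_derivative ?Dh) (at x)"
    using C1_on_has_derivative slice_chart_C1 slice_chart_facts by blast
  have Dk: "(k has_derivative frechet_derivative k (at (h x))) (at (h x))"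
    using C1_on_has_derivative slice_chart_C1 slice_chart_facts by blast
  have "((\<lambda>y. y) has_derivative (\<lambda>w. frechet_derivative k (at (h x)) (?Dh w))) (at x)"
    by (rule has_derivative_transform_within_open[OF has_derivative_compose[OF Dh Dk] slice_chart_facts(2,3)])
      (simp add: slice_chart_inverse)
  with has_derivative_ident[of "at x"] have "frechet_derivative k (at (h x)) (?Dh v) = v"
    using has_derivative_unique by (metis (mono_tags, lifting))
  \<comment> \<open>Near 0 the curve runs in the chart, where M is flattened to \<open>L\<close>. So
    the difference quotients of \<open>h \<circ> c\<close> lie in \<open>L\<close>, and a subspace
    is closed.\<close>
  moreover have "?Dh v \<in> L"
  proof -
    have "isCont c 0"
      using c(2) has_vector_derivative_continuous by blast
    then have "eventually (\<lambda>t. c t \<in> U) (at 0)"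
      using slice_chart_facts(2,3) c(1) by (auto simp: isCont_def tendsto_def)
    moreover have "eventually (\<lambda>t. t \<in> {- e<..<e}) (at 0)"
      using e(1) by (intro eventually_at_in_open') auto
    ultimately have "eventually (\<lambda>t. (1 / t) *\<^sub>R (h (c t) - h (c 0)) \<in> L) (at 0)"
    proof eventually_elim
      case (elim t)
      then have "h (c t) \<in> L" "h (c 0) \<in> L"
        using slice_chart_slice image_subset_iff[THEN iffD1, OF e(2)] slice_chart_facts(1,3) c(1) by auto
      then show ?case
        using slice_chart_facts(5) by (simp add: subspace_diff subspace_scale)
    qed
    moreover have "((\<lambda>t. (1 / t) *\<^sub>R (h (c t) - h (c 0))) \<longlongrightarrow> ?Dh v) (at 0)"
    proof -
      have "((\<lambda>t. h (c t)) has_derivative (\<lambda>s. ?Dh (s *\<^sub>R v))) (at 0)"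
        using has_derivative_compose[of c "\<lambda>s. s *\<^sub>R v" 0 UNIV h ?Dh] c Dh
        by (simp add: has_vector_derivative_def)
      then have "((\<lambda>t. h (c t)) has_vector_derivative ?Dh v) (at 0)"
        using has_derivative_linear[OF Dh] by (simp add: has_vector_derivative_def linear_scale)
      then have lim: "((\<lambda>t. norm (h (c t) - h (c 0) - t *\<^sub>R ?Dh v) / \<bar>t\<bar>) \<longlongrightarrow> 0) (at 0)"
        by (simp add: has_vector_derivative_def has_derivative_at)
      have quot: "norm (A - t *\<^sub>R B) / \<bar>t\<bar> = norm ((1 / t) *\<^sub>R A - B)"
        if "t \<noteq> 0" for A B :: 'a and t :: real
      proof -
        have "(1 / t) *\<^sub>R A - B = (1 / t) *\<^sub>R (A - t *\<^sub>R B)"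
          using that by (simp add: scaleR_right_diff_distrib)
        then show ?thesis
          by simp
      qed
      have "((\<lambda>t. norm ((1 / t) *\<^sub>R (h (c t) - h (c 0)) - ?Dh v)) \<longlongrightarrow> 0) (at 0)"
        by (rule Lim_transform_eventually[OF lim]) (simp add: eventually_at_filter quot)
      then show ?thesis
        by (rule LIM_zero_cancel[OF tendsto_norm_zero_cancel])
    qed
    ultimately show ?thesis
      using Lim_in_closed_set[OF closed_subspace[OF slice_chart_facts(5)]] by fastforce
  qed
  ultimately show ?thesis
    by force
qed

lemma tangent_space_slice_chart: "tangent_space M x = frechet_derivative k (at (h x)) ` L"
proof (rule subset_antisym; rule subsetI)
  fix v assume "v \<in> tangent_space M x"
  then obtain c where "smooth_curve_through M x c v"
    unfolding tangent_space_def mem_Collect_eq by (elim exE)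
  then show "v \<in> frechet_derivative k (at (h x)) ` L"
    by (rule slice_chart_curve_tangent)
next
  fix v assume "v \<in> frechet_derivative k (at (h x)) ` L"
  then obtain l where "l \<in> L" "v = frechet_derivative k (at (h x)) l"
    by (elim imageE)
  then show "v \<in> tangent_space M x"
    unfolding tangent_space_def mem_Collect_eq using slice_chart_curve[of l] by simp
qed

lemma subspace_tangent_space: "subspace (tangent_space M x)"
proof -
  have "linear (frechet_derivative k (at (h x)))"
    using C1_on_has_derivative[OF slice_chart_C1(2)] slice_chart_facts has_derivative_linear by blast
  then show ?thesis
    unfolding tangent_space_slice_chart by (rule linear_subspace_image) (rule slice_chart_facts)
qed

end

lemma curve_derivative_C1_at:
  assumes "C1_at M f g x" "smooth_curve_through M x c v"
  shows "(f \<circ> c has_real_derivative frechet_derivative g (at x) v) (at 0)"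
proof -
  obtain W where W: "open W" "x \<in> W" "C1_on W g" "\<And>y. y \<in> M \<inter> W \<Longrightarrow> f y = g y"
    using assms(1) unfolding C1_at_def by blast
  obtain e where e: "e > 0" "c ` {- e<..<e} \<subseteq> M" and c: "c 0 = x" "(c has_vector_derivative v) (at 0)"
    using assms(2) unfolding smooth_curve_through_def by blast
  have Dg: "(g has_derivative frechet_derivative g (at x)) (at x)"
    by (rule C1_on_has_derivative[OF W(3,2)])
  have "((\<lambda>t. g (c t)) has_derivative (\<lambda>s. frechet_derivative g (at x) (s *\<^sub>R v))) (at 0)"
    using has_derivative_compose[of c "\<lambda>s. s *\<^sub>R v" 0 UNIV g] c Dg
    by (simp add: has_vector_derivative_def)
  moreover have "isCont c 0"
    using c(2) has_vector_derivative_continuous by blast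
  \<comment> \<open>With \<open>nhds 0\<close> in place of \<open>at 0\<close> the point 0 itself is
    included, as needed to replace \<open>g\<close> by \<open>f\<close> on an open set around
    0.\<close>
  then have "eventually (\<lambda>t. c t \<in> W) (nhds 0)"
    using topological_tendstoD[of c "c 0" "nhds 0" W] W(1,2) c(1)
    unfolding isCont_def tendsto_at_iff_tendsto_nhds by simp
  moreover have "eventually (\<lambda>t. t \<in> {- e<..<e}) (nhds 0)"
    using e(1) by (intro eventually_nhds_in_open) auto
  ultimately have "((f \<circ> c) has_derivative (\<lambda>s. frechet_derivative g (at x) (s *\<^sub>R v))) (at 0)"
  proof -
    assume 1: "eventually (\<lambda>t. c t \<in> W) (nhds 0)" "eventually (\<lambda>t. t \<in> {- e<..<e}) (nhds 0)"
      and 2: "((\<lambda>t. g (c t)) has_derivative (\<lambda>s. frechet_derivative g (at x) (s *\<^sub>R v))) (at 0)"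
    from 1 have "eventually (\<lambda>t. g (c t) = (f \<circ> c) t) (nhds 0)"
      by eventually_elim (use image_subset_iff[THEN iffD1, OF e(2)] W(4) in auto)
    then obtain S where "open S" "0 \<in> S" "\<And>t. t \<in> S \<Longrightarrow> g (c t) = (f \<circ> c) t"
      unfolding eventually_nhds by blast
    with has_derivative_transform_within_open[OF 2] show ?thesis
      by blast
  qed
  moreover have "(\<lambda>s. frechet_derivative g (at x) (s *\<^sub>R v)) = (*) (frechet_derivative g (at x) v)"
    using has_derivative_linear[OF Dg] by (simp add: linear_scale fun_eq_iff mult.commute)
  ultimately show ?thesis
    by (simp add: has_field_derivative_def)
qed

text \<open>The definite description is justified by Riesz representation on the tangent space. The
  derivative of \<open>f\<close> along a curve is that of the ambient extension \<open>g\<close> in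
  the direction of its velocity, so the condition on curves becomes one on tangent vectors.\<close>

lemma manifold_gradient_inner:
  assumes "smooth_submanifold m M" "x \<in> M" "C1_at M f g x"
  shows "manifold_gradient M f x \<in> tangent_space M x"
    and "v \<in> tangent_space M x \<Longrightarrow> frechet_derivative g (at x) v = manifold_gradient M f x \<bullet> v"
proof -
  obtain U V L h k where "slice_chart M x U V L h k"
    using smooth_submanifold_slice_chart[OF assms(1,2)] .
  then have T: "subspace (tangent_space M x)"
    by (rule subspace_tangent_space)
  let ?D = "frechet_derivative g (at x)"
  let ?P = "\<lambda>G. G \<in> tangent_space M x \<and>
       (\<forall>c v. smooth_curve_through M x c v \<longrightarrow> (f \<circ> c has_real_derivative G \<bullet> v) (at 0))"
  have P: "?P G \<longleftrightarrow> G \<in> tangent_space M x \<and> (\<forall>v\<in>tangent_space M x. ?D v = G \<bullet> v)" for G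
  proof -
    have "(f \<circ> c has_real_derivative G \<bullet> v) (at 0) \<longleftrightarrow> ?D v = G \<bullet> v"
      if "smooth_curve_through M x c v" for c v
      using curve_derivative_C1_at[OF assms(3) that] DERIV_unique by metis
    then have "(\<forall>c v. smooth_curve_through M x c v \<longrightarrow> (f \<circ> c has_real_derivative G \<bullet> v) (at 0)) \<longleftrightarrow>
        (\<forall>c v. smooth_curve_through M x c v \<longrightarrow> ?D v = G \<bullet> v)"
      by simp
    also have "\<dots> \<longleftrightarrow> (\<forall>v\<in>tangent_space M x. ?D v = G \<bullet> v)"
      unfolding tangent_space_def by auto
    finally show ?thesis
      by simp
  qed
  have lin: "linear ?D"
    using assms(3) C1_on_has_derivative[THEN has_derivative_linear] unfolding C1_at_def by blast
  have "\<exists>!G. ?P G"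
    unfolding P
  proof (rule ex_ex1I)
    \<comment> \<open>\<open>?r\<close> is the ambient gradient of \<open>g\<close>; its orthogonal
      projection to the tangent space is the gradient sought.\<close>
    let ?r = "\<Sum>b\<in>Basis. ?D b *\<^sub>R b"
    obtain G z where G: "G \<in> span (tangent_space M x)" "\<And>w. w \<in> span (tangent_space M x) \<Longrightarrow> orthogonal z w" "?r = G + z"
      using orthogonal_subspace_decomp_exists[of "tangent_space M x" ?r] by metis
    have "?D v = G \<bullet> v" if "v \<in> tangent_space M x" for v
    proof -
      have "?D v = ?D (\<Sum>b\<in>Basis. (v \<bullet> b) *\<^sub>R b)"
        by (simp add: euclidean_representation)
      also have "\<dots> = ?r \<bullet> v"
        by (simp add: linear_sum[OF lin] linear_scale[OF lin] inner_sum_left inner_commute[of v] mult.commute)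
      also have "\<dots> = G \<bullet> v"
        using G(2)[OF span_base[OF that]] by (simp add: G(3) inner_left_distrib orthogonal_def)
      finally show ?thesis .
    qed
    moreover have "G \<in> tangent_space M x"
      using G(1) T by (simp add: span_eq_iff[THEN iffD2])
    ultimately show "\<exists>G. G \<in> tangent_space M x \<and> (\<forall>v\<in>tangent_space M x. ?D v = G \<bullet> v)"
      by blast
  next
    fix G G' assume *: "G \<in> tangent_space M x \<and> (\<forall>v\<in>tangent_space M x. ?D v = G \<bullet> v)"
      "G' \<in> tangent_space M x \<and> (\<forall>v\<in>tangent_space M x. ?D v = G' \<bullet> v)"
    then have "G - G' \<in> tangent_space M x"
      using T by (simp add: subspace_diff)
    \<comment> \<open>The difference is itself tangent, so it can be tested against itself.\<close>
    then have "(G - G') \<bullet> (G - G') = 0"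
      using * by (simp add: inner_diff_left)
    then show "G = G'"
      by simp
  qed
  from theI'[OF this] have "?P (manifold_gradient M f x)"
    unfolding manifold_gradient_def .
  then show "manifold_gradient M f x \<in> tangent_space M x"
    and "v \<in> tangent_space M x \<Longrightarrow> frechet_derivative g (at x) v = manifold_gradient M f x \<bullet> v"
    unfolding P by simp_all
qed

section \<open>Deformations that decrease a function\<close>

text \<open>A mere decrease in the weak sense would not compose well: a point moved along its level
  could leave the region where the next deformation is strict. As a point is either fixed or
  strictly lowered, a strict decrease at x by either end map makes the composite strict at
  x.\<close>

definition downward_deformation ::
    "'a::topological_space set \<Rightarrow> ('a \<Rightarrow> real) \<Rightarrow> (real \<times> 'a \<Rightarrow> 'a) \<Rightarrow> bool" where
  "downward_deformation M f H \<longleftrightarrow> continuous_on ({0..1} \<times> M) H \<and> (\<forall>x\<in>M. H (0, x) = x) \<and>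
     (\<forall>t\<in>{0..1}. \<forall>x\<in>M. H (t, x) \<in> M \<and> (H (t, x) = x \<or> f (H (t, x)) < f x))"

lemma downward_deformationD:
  assumes "downward_deformation M f H"
  shows "continuous_on ({0..1} \<times> M) H" "x \<in> M \<Longrightarrow> H (0, x) = x"
    "x \<in> M \<Longrightarrow> 0 \<le> t \<Longrightarrow> t \<le> 1 \<Longrightarrow> H (t, x) \<in> M"
    "x \<in> M \<Longrightarrow> 0 \<le> t \<Longrightarrow> t \<le> 1 \<Longrightarrow> H (t, x) = x \<or> f (H (t, x)) < f x"
    "x \<in> M \<Longrightarrow> 0 \<le> t \<Longrightarrow> t \<le> 1 \<Longrightarrow> f (H (t, x)) \<le> f x"
  using assms unfolding downward_deformation_def by force+

lemma downward_deformation_compose: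
  assumes H: "downward_deformation M f H" and G: "downward_deformation M f G"
  shows "downward_deformation M f (\<lambda>(t, x). G (t, H (t, x)))"
    and "x \<in> M \<Longrightarrow> f (H (1, x)) < f x \<or> f (G (1, x)) < f x \<Longrightarrow> f (G (1, H (1, x))) < f x"
proof -
  note H' = downward_deformationD[OF H] and G' = downward_deformationD[OF G]
  show "downward_deformation M f (\<lambda>(t, x). G (t, H (t, x)))"
    unfolding downward_deformation_def
  proof (intro conjI ballI)
    show "continuous_on ({0..1} \<times> M) (\<lambda>(t, x). G (t, H (t, x)))"
    proof (unfold case_prod_beta, rule continuous_on_compose2[OF G'(1)])
      show "continuous_on ({0..1} \<times> M) (\<lambda>z. (fst z, H (fst z, snd z)))"
        using H'(1) by (simp add: continuous_on_Pair continuous_on_fst continuous_on_id)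
      show "(\<lambda>z. (fst z, H (fst z, snd z))) ` ({0..1} \<times> M) \<subseteq> {0..1} \<times> M"
        using H'(3) by auto
    qed
  next
    fix x assume "x \<in> M"
    then show "(\<lambda>(t, x). G (t, H (t, x))) (0, x) = x"
      using H'(2) G'(2) by simp
  next
    fix t :: real and x assume *: "t \<in> {0..1}" "x \<in> M"
    then have "H (t, x) \<in> M"
      using H'(3) by simp
    with * show "(\<lambda>(t, x). G (t, H (t, x))) (t, x) \<in> M"
      using G'(3) by simp
    show "(\<lambda>(t, x). G (t, H (t, x))) (t, x) = x \<or> f ((\<lambda>(t, x). G (t, H (t, x))) (t, x)) < f x"
      using * H'(4)[of x t] G'(4)[of "H (t, x)" t] \<open>H (t, x) \<in> M\<close> by force
  qed
  show "f (G (1, H (1, x))) < f x" if "x \<in> M" "f (H (1, x)) < f x \<or> f (G (1, x)) < f x"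
    using that H'(4)[of x 1] H'(3)[of x 1] G'(5)[of "H (1, x)" 1] by force
qed

lemma downward_deformation_cover:
  assumes "compact K" "K \<subseteq> M"
    and local: "\<And>x. x \<in> K \<Longrightarrow> \<exists>V H. open V \<and> x \<in> V \<and> downward_deformation M f H \<and>
           (\<forall>y\<in>M \<inter> V. f (H (1, y)) < f y)"
  shows "\<exists>H. downward_deformation M f H \<and> (\<forall>y\<in>K. f (H (1, y)) < f y)"
proof -
  define Q where "Q x V H \<longleftrightarrow> open V \<and> x \<in> V \<and> downward_deformation M f H \<and>
      (\<forall>y\<in>M \<inter> V. f (H (1, y)) < f y)" for x V H
  have "\<forall>x\<in>K. \<exists>V H. Q x V H"
    unfolding Q_def by (intro ballI local)
  then obtain V H where VH: "\<And>x. x \<in> K \<Longrightarrow> Q x (V x) (H x)"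
    by metis
  have "\<exists>G. downward_deformation M f G \<and> (\<forall>y\<in>M \<inter> (\<Union>x\<in>D. V x). f (G (1, y)) < f y)"
    if "finite D" "D \<subseteq> K" for D
    using that
  proof (induction D rule: finite_induct)
    case empty
    have "downward_deformation M f snd"
      by (auto simp: downward_deformation_def continuous_on_snd)
    then show ?case
      by (intro exI[of _ snd]) simp
  next
    case (insert x D)
    from insert.prems have "D \<subseteq> K"
      by simp
    from insert.IH[OF this] obtain G
      where G: "downward_deformation M f G" "\<forall>y\<in>M \<inter> (\<Union>x\<in>D. V x). f (G (1, y)) < f y"
      by (elim exE conjE)
    have Hx: "downward_deformation M f (H x)" "\<forall>y\<in>M \<inter> V x. f (H x (1, y)) < f y"
      using VH[of x] insert.prems by (simp_all add: Q_def)
    show ?case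
    proof (intro exI conjI ballI)
      show "downward_deformation M f (\<lambda>(t, y). H x (t, G (t, y)))"
        by (rule downward_deformation_compose(1)[OF G(1) Hx(1)])
      fix y assume "y \<in> M \<inter> (\<Union>x\<in>insert x D. V x)"
      then have "y \<in> M" "f (G (1, y)) < f y \<or> f (H x (1, y)) < f y"
        using G(2) Hx(2) by auto
      then show "f ((\<lambda>(t, y). H x (t, G (t, y))) (1, y)) < f y"
        using downward_deformation_compose(2)[OF G(1) Hx(1)] by simp
    qed
  qed
  moreover obtain D where "finite D" "D \<subseteq> K" "K \<subseteq> (\<Union>x\<in>D. V x)"
  proof (rule compactE_image[OF assms(1), of K V])
    show "open (V x)" if "x \<in> K" for x
      using VH[OF that] by (simp add: Q_def)
    show "K \<subseteq> (\<Union>x\<in>K. V x)"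
      using VH by (auto simp: Q_def)
  qed
  ultimately have "\<exists>G. downward_deformation M f G \<and> (\<forall>y\<in>M \<inter> (\<Union>x\<in>D. V x). f (G (1, y)) < f y)"
    by simp
  then obtain G where "downward_deformation M f G" "\<forall>y\<in>M \<inter> (\<Union>x\<in>D. V x). f (G (1, y)) < f y"
    by (elim exE conjE)
  then show ?thesis
    using \<open>K \<subseteq> (\<Union>x\<in>D. V x)\<close> assms(2) by (intro exI[of _ G] conjI ballI) auto
qed

text \<open>The function \<open>max (f x - w) (w - f (H (1, x)))\<close> is positive everywhere: by
  its first term above the level w, by its second term on the level (\<open>strict\<close>) and
  below it (monotonicity). Half of its minimum m over the compact M serves as \<epsilon>: where
  \<open>f x - w\<close> is at most \<open>m / 2\<close>, the second term must be at least
  m.\<close>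

lemma downward_deformation_push:
  assumes "compact M" "M \<noteq> {}" "continuous_on M f" "downward_deformation M f H"
    and strict: "\<And>x. x \<in> M \<Longrightarrow> f x = w \<Longrightarrow> f (H (1, x)) < f x"
  shows "\<exists>\<epsilon>>0. \<forall>x\<in>M. f x \<le> w + \<epsilon> \<longrightarrow> f (H (1, x)) \<le> w - \<epsilon>"
proof -
  note H = downward_deformationD[OF assms(4)]
  have "continuous_on M (\<lambda>x. H (1, x))"
    by (rule continuous_on_homotopy_end[OF H(1)])
  then have "continuous_on M (\<lambda>x. f (H (1, x)))"
    using H(3) by (intro continuous_on_compose2[OF assms(3)]) auto
  then have "continuous_on M (\<lambda>x. max (f x - w) (w - f (H (1, x))))"
    using assms(3) by (intro continuous_on_max continuous_on_diff continuous_on_const)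
  then obtain z where z: "z \<in> M" "\<And>x. x \<in> M \<Longrightarrow> max (f z - w) (w - f (H (1, z))) \<le> max (f x - w) (w - f (H (1, x)))"
    using continuous_attains_inf[OF assms(1,2)] by blast
  define m where "m = max (f z - w) (w - f (H (1, z)))"
  have "m > 0"
    using strict[OF z(1)] H(5)[OF z(1), of 1] by (cases "f z = w") (auto simp: m_def max_def)
  moreover have "f (H (1, x)) \<le> w - m / 2" if "x \<in> M" "f x \<le> w + m / 2" for x
    using z(2)[OF that(1), folded m_def] that(2) \<open>m > 0\<close> by (auto simp: max_def split: if_splits)
  ultimately show ?thesis
    by (intro exI[of _ "m / 2"]) auto
qed

lemma slice_chart_downward_deformation:
  assumes chart: "slice_chart M x U V L h k" and "compact M"
    and r: "0 < r" "cball (h x) r \<subseteq> V" and l: "l \<in> L"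
    and descent: "\<And>y s. y \<in> L \<Longrightarrow> y \<in> cball (h x) r \<Longrightarrow> 0 < s \<Longrightarrow> y + s *\<^sub>R l \<in> cball (h x) r \<Longrightarrow>
        f (k (y + s *\<^sub>R l)) < f (k y)"
  shows "\<exists>W H. open W \<and> x \<in> W \<and> downward_deformation M f H \<and> (\<forall>y\<in>M \<inter> W. f (H (1, y)) < f y)"
proof -
  \<comment> \<open>The factor vanishes on the sphere of radius \<open>r / 2\<close>, so the motion
    extends by the identity. Dividing by \<open>norm l + 1\<close> bounds the displacement by the
    distance to that sphere; the summand 1 keeps the denominator positive even for
    \<open>l = 0\<close>.\<close>
  define \<rho> where "\<rho> y = (r / 2 - dist (h x) y) / (norm l + 1)" for y
  define P where "P y \<longleftrightarrow> y \<in> U \<and> h y \<in> cball (h x) (r / 2)" for y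
  define F where "F z = k (h (snd z) + (fst z * \<rho> (h (snd z))) *\<^sub>R l)" for z
  define H where "H z = (if P (snd z) then F z else snd z)" for z
  \<comment> \<open>\<open>A\<close> and \<open>B\<close> are closed, cover M and overlap only where
    the factor vanishes, so the two branches of \<open>H\<close> can be glued.\<close>
  define A where "A = k ` (cball (h x) (r / 2) \<inter> L)"
  define W where "W = U \<inter> h -` ball (h x) (r / 2)"
  define B where "B = M - W"
  note facts = slice_chart_facts[OF chart]
  have conth: "continuous_on U h" and contk: "continuous_on V k"
    using slice_chart_C1[OF chart] by (simp_all add: C1_on_continuous_on)
  have sub: "cball (h x) (r / 2) \<subseteq> cball (h x) r"
    using r(1) by (intro subset_cball) simp
  have "open W"
    unfolding W_def by (rule continuous_open_preimage[OF conth facts(2) open_ball])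
  have A: "A = {y \<in> M. P y}"
  proof (rule subset_antisym; rule subsetI)
    fix y assume "y \<in> A"
    then obtain z where z: "z \<in> cball (h x) (r / 2)" "z \<in> L" "y = k z"
      unfolding A_def by (elim imageE IntE)
    then have "z \<in> V"
      using sub r(2) by blast
    then show "y \<in> {y \<in> M. P y}"
      using z slice_chart_slice_inverse[OF chart, of z] slice_chart_inverse(3,4)[OF chart, of z]
      by (simp add: P_def)
  next
    fix y assume "y \<in> {y \<in> M. P y}"
    then have y: "y \<in> M" "y \<in> U" "h y \<in> cball (h x) (r / 2)"
      by (simp_all add: P_def)
    then have "h y \<in> cball (h x) (r / 2) \<inter> L" "y = k (h y)"
      using slice_chart_slice[OF chart, of y] slice_chart_inverse(2)[OF chart, of y] by simp_all
    then show "y \<in> A"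
      unfolding A_def by (rule rev_image_eqI)
  qed
  \<comment> \<open>That \<open>A\<close> is closed in the ambient space is not visible from
    \<open>P\<close>, which refers to the open set \<open>U\<close>; it follows from compactness of
    the ball intersected with \<open>L\<close>.\<close>
  have "compact A"
    unfolding A_def
  proof (rule compact_continuous_image)
    show "continuous_on (cball (h x) (r / 2) \<inter> L) k"
      using sub r(2) by (intro continuous_on_subset[OF contk]) blast
    show "compact (cball (h x) (r / 2) \<inter> L)"
      by (intro compact_Int_closed compact_cball closed_subspace facts)
  qed
  have "closed B"
    unfolding B_def using \<open>compact M\<close> \<open>open W\<close> by (intro closed_Diff compact_imp_closed)
  have \<rho>_nonneg: "0 \<le> \<rho> y" if "y \<in> cball (h x) (r / 2)" for y
    using that by (simp add: \<rho>_def)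
  have move: "y + (t * \<rho> y) *\<^sub>R l \<in> cball (h x) (r / 2)"
    if y: "y \<in> cball (h x) (r / 2)" and t: "0 \<le> t" "t \<le> 1" for y t
  proof -
    have "norm ((t * \<rho> y) *\<^sub>R l) = t * \<rho> y * norm l"
      using \<rho>_nonneg[OF y] t by simp
    also have "\<dots> \<le> 1 * \<rho> y * (norm l + 1)"
      using \<rho>_nonneg[OF y] t by (intro mult_mono) auto
    also have "\<dots> = r / 2 - dist (h x) y"
      by (simp add: \<rho>_def add_nonneg_eq_0_iff)
    finally have "norm ((t * \<rho> y) *\<^sub>R l) \<le> r / 2 - dist (h x) y" .
    moreover have "dist (h x) (y + (t * \<rho> y) *\<^sub>R l) \<le> dist (h x) y + norm ((t * \<rho> y) *\<^sub>R l)"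
      using dist_triangle[of "h x" "y + (t * \<rho> y) *\<^sub>R l" y] by (simp add: dist_norm)
    ultimately show ?thesis
      by simp
  qed
  have contF: "continuous_on ({0..1} \<times> A) F"
    unfolding F_def
  proof (rule continuous_on_compose2[OF contk])
    have "continuous_on ({0..1} \<times> A) (\<lambda>z. h (snd z))"
      by (rule continuous_on_compose2[OF conth]) (auto simp: A P_def intro: continuous_intros)
    then show "continuous_on ({0..1} \<times> A) (\<lambda>z. h (snd z) + (fst z * \<rho> (h (snd z))) *\<^sub>R l)"
      unfolding \<rho>_def by (intro continuous_intros) (auto simp: add_nonneg_eq_0_iff)
    show "(\<lambda>z. h (snd z) + (fst z * \<rho> (h (snd z))) *\<^sub>R l) ` ({0..1} \<times> A) \<subseteq> V"
      using move sub r(2) by (force simp: A P_def)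
  qed
  have "continuous_on ({0..1} \<times> A \<union> {0..1} \<times> B) (\<lambda>z. if P (snd z) then F z else snd z)"
  proof (rule continuous_on_cases)
    show "closed ({0..1::real} \<times> A)"
      by (rule closed_Times[OF closed_atLeastAtMost compact_imp_closed[OF \<open>compact A\<close>]])
    show "closed ({0..1::real} \<times> B)"
      by (rule closed_Times[OF closed_atLeastAtMost \<open>closed B\<close>])
    show "continuous_on ({0..1} \<times> A) F"
      by (rule contF)
    show "continuous_on ({0..1::real} \<times> B) snd"
      by (intro continuous_intros)
    show "\<forall>z. z \<in> {0..1} \<times> A \<and> \<not> P (snd z) \<or> z \<in> {0..1} \<times> B \<and> P (snd z) \<longrightarrow> F z = snd z"
    proof (intro allI impI)
      fix z :: "real \<times> 'a" assume "z \<in> {0..1} \<times> A \<and> \<not> P (snd z) \<or> z \<in> {0..1} \<times> B \<and> P (snd z)"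
      then have "P (snd z)" "snd z \<notin> W"
        using A by (auto simp: B_def)
      then have "snd z \<in> U" "dist (h x) (h (snd z)) = r / 2"
        by (simp_all add: W_def P_def)
      moreover from this have "\<rho> (h (snd z)) = 0"
        by (simp only: \<rho>_def) simp
      ultimately show "F z = snd z"
        using slice_chart_inverse(2)[OF chart] by (simp add: F_def)
    qed
  qed
  moreover have "A \<union> B = M"
    by (auto simp: A B_def W_def P_def)
  ultimately have "continuous_on ({0..1} \<times> M) H"
    unfolding H_def by (simp flip: Sigma_Un_distrib2)
  have FM: "F (t, y) \<in> M \<and> f (F (t, y)) < f y"
    if "y \<in> M" "P y" "0 \<le> t" "t \<le> 1" "0 < t * \<rho> (h y)" for t y
  proof -
    have y: "y \<in> U" "h y \<in> cball (h x) (r / 2)" "h y \<in> L"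
      using that slice_chart_slice[OF chart] by (simp_all add: P_def)
    let ?z = "h y + (t * \<rho> (h y)) *\<^sub>R l"
    have "?z \<in> cball (h x) (r / 2)"
      by (rule move[OF y(2) that(3,4)])
    then have z: "?z \<in> cball (h x) r"
      using sub by blast
    have "?z \<in> L"
      using facts(5) y(3) l by (simp add: subspace_add subspace_scale)
    then have "k ?z \<in> M"
      using slice_chart_slice_inverse[OF chart] z r(2) by blast
    moreover have "f (k ?z) < f (k (h y))"
      by (rule descent[OF y(3) _ that(5) z]) (use sub y(2) in blast)
    ultimately show ?thesis
      by (simp add: F_def slice_chart_inverse(2)[OF chart y(1)])
  qed
  have F0: "F (t, y) = y" if "P y" "t * \<rho> (h y) = 0" for t y
  proof -
    have "F (t, y) = k (h y + 0 *\<^sub>R l)"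
      unfolding F_def fst_conv snd_conv that(2) ..
    then show ?thesis
      using that(1) slice_chart_inverse(2)[OF chart] by (simp add: P_def)
  qed
  have "downward_deformation M f H"
    unfolding downward_deformation_def
  proof (intro conjI ballI)
    show "continuous_on ({0..1} \<times> M) H"
      by fact
    show "H (0, y) = y" for y
      using F0[of y 0] by (simp add: H_def)
    fix t :: real and y assume t: "t \<in> {0..1}" and y: "y \<in> M"
    have cases: "H (t, y) = y \<or> H (t, y) \<in> M \<and> f (H (t, y)) < f y"
    proof (cases "P y")
      case True
      then have "0 \<le> t * \<rho> (h y)"
        using t \<rho>_nonneg by (simp add: P_def)
      then consider "t * \<rho> (h y) = 0" | "0 < t * \<rho> (h y)"
        by linarith
      then show ?thesis
      proof cases
        case 1
        then show ?thesis
          using F0[OF True] by (simp add: H_def True)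
      next
        case 2
        then show ?thesis
          using FM[OF y True] t by (simp add: H_def True)
      qed
    qed (simp add: H_def)
    then show "H (t, y) = y \<or> f (H (t, y)) < f y"
      by (elim disjE conjE) simp_all
    show "H (t, y) \<in> M"
      using cases y by (elim disjE conjE) simp_all
  qed
  moreover have "x \<in> W"
    using r(1) facts by (simp add: W_def)
  moreover have "f (H (1, y)) < f y" if "y \<in> M \<inter> W" for y
  proof -
    have "dist (h x) (h y) < r / 2" "P y"
      using that by (simp_all add: P_def W_def)
    moreover from this have "0 < 1 * \<rho> (h y)"
      unfolding \<rho>_def by (simp add: add_nonneg_pos)
    ultimately show ?thesis
      using FM[of y 1] that by (simp add: H_def)
  qed
  ultimately show ?thesis
    using \<open>open W\<close> by (intro exI[of _ W] exI[of _ H]) simp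
qed

text \<open>The derivative in direction \<open>l\<close> stays negative on a small ball. Convexity
  of the ball keeps the whole segment from \<open>y\<close> to \<open>y + s *\<^sub>R l\<close>
  inside, so \<open>E\<close> decreases along it, with one radius for all \<open>y\<close>.\<close>

lemma C1_descent:
  fixes E :: "'a::euclidean_space \<Rightarrow> real"
  assumes "open N" "y0 \<in> N" "C1_on N E" "frechet_derivative E (at y0) l < 0"
  shows "\<exists>r>0. cball y0 r \<subseteq> N \<and>
    (\<forall>y s. y \<in> cball y0 r \<longrightarrow> 0 < s \<longrightarrow> y + s *\<^sub>R l \<in> cball y0 r \<longrightarrow> E (y + s *\<^sub>R l) < E y)"
proof -
  have "continuous_on N (\<lambda>z. frechet_derivative E (at z) l)"
    using assms(3) by (simp add: C1_on_def)
  then have "open (N \<inter> (\<lambda>z. frechet_derivative E (at z) l) -` {..<0})"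
    using assms(1) by (rule continuous_open_preimage) simp
  moreover have "y0 \<in> N \<inter> (\<lambda>z. frechet_derivative E (at z) l) -` {..<0}"
    using assms by simp
  ultimately obtain r where r: "r > 0" "cball y0 r \<subseteq> N \<inter> (\<lambda>z. frechet_derivative E (at z) l) -` {..<0}"
    by (meson open_contains_cball)
  have "E (y + s *\<^sub>R l) < E y" if y: "y \<in> cball y0 r" and s: "0 < s" and ys: "y + s *\<^sub>R l \<in> cball y0 r" for y s
  proof -
    have der: "((\<lambda>t. E (y + t *\<^sub>R l)) has_real_derivative frechet_derivative E (at (y + t *\<^sub>R l)) l) (at t)"
      and neg: "frechet_derivative E (at (y + t *\<^sub>R l)) l < 0" if t: "0 \<le> t" "t \<le> s" for t
    proof -
      have "y + t *\<^sub>R l = (1 - t / s) *\<^sub>R y + (t / s) *\<^sub>R (y + s *\<^sub>R l)"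
        using s by (simp add: algebra_simps)
      moreover have "(1 - t / s) *\<^sub>R y + (t / s) *\<^sub>R (y + s *\<^sub>R l) \<in> cball y0 r"
        using t s by (intro convexD_alt[OF convex_cball y ys]) auto
      ultimately have in_r: "y + t *\<^sub>R l \<in> cball y0 r"
        by simp
      then show "frechet_derivative E (at (y + t *\<^sub>R l)) l < 0"
        using r(2) by auto
      have E': "(E has_derivative frechet_derivative E (at (y + t *\<^sub>R l))) (at (y + t *\<^sub>R l))"
        using in_r r(2) by (intro C1_on_has_derivative[OF assms(3)]) auto
      have "((\<lambda>t. y + t *\<^sub>R l) has_derivative (\<lambda>u. u *\<^sub>R l)) (at t)"
        by (auto intro!: derivative_eq_intros)
      from has_derivative_compose[OF this E']
      have "((\<lambda>t. E (y + t *\<^sub>R l)) has_derivative (\<lambda>u. frechet_derivative E (at (y + t *\<^sub>R l)) (u *\<^sub>R l))) (at t)" .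
      moreover have "(\<lambda>u. frechet_derivative E (at (y + t *\<^sub>R l)) (u *\<^sub>R l)) = (*) (frechet_derivative E (at (y + t *\<^sub>R l)) l)"
        using has_derivative_linear[OF E'] by (simp add: linear_scale fun_eq_iff mult.commute)
      ultimately show "((\<lambda>t. E (y + t *\<^sub>R l)) has_real_derivative frechet_derivative E (at (y + t *\<^sub>R l)) l) (at t)"
        by (simp add: has_field_derivative_def)
    qed
    have "E (y + s *\<^sub>R l) < E (y + 0 *\<^sub>R l)"
    proof (rule DERIV_neg_imp_decreasing[OF s])
      fix t assume "0 \<le> t" "t \<le> s"
      then show "\<exists>d. ((\<lambda>t. E (y + t *\<^sub>R l)) has_real_derivative d) (at t) \<and> d < 0"
        using der neg by blast
    qed
    then show ?thesis
      by simp
  qed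
  then show ?thesis
    using r by (intro exI[of _ r]) auto
qed
text \<open>\<open>\<Phi>\<close> stands for the maximum of \<open>F\<close> and another function.\<close>

lemma slice_chart_component_descent:
  fixes F \<Phi> p :: "'a::euclidean_space \<Rightarrow> real"
  assumes chart: "slice_chart M x U V L h k" and l: "l \<in> L"
    and F: "continuous_on M F" and \<Phi>: "continuous_on M \<Phi>" "\<And>y. y \<in> M \<Longrightarrow> F y \<le> \<Phi> y"
    and mono: "\<And>y z. p y < p z \<Longrightarrow> F y < F z"
    and alt: "F x < \<Phi> x \<or> (\<exists>g. C1_at M p g x \<and> frechet_derivative g (at x) (frechet_derivative k (at (h x)) l) < 0)"
  shows "\<exists>r>0. cball (h x) r \<subseteq> V \<and> (\<forall>y s. y \<in> L \<longrightarrow> y \<in> cball (h x) r \<longrightarrow> 0 < s \<longrightarrow>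
     y + s *\<^sub>R l \<in> cball (h x) r \<longrightarrow> F (k (y + s *\<^sub>R l)) < \<Phi> (k y))"
  using alt
proof
  note facts = slice_chart_facts[OF chart]
  have step: "y + s *\<^sub>R l \<in> L" if "y \<in> L" for y s
    using that l facts(5) by (simp add: subspace_add subspace_scale)
  have kx: "k (h x) = x"
    using slice_chart_inverse(2)[OF chart] facts by simp
  {
    assume less: "F x < \<Phi> x"
    \<comment> \<open>By continuity the midpoint separates \<open>F\<close> from
      \<open>\<Phi>\<close> also at different nearby points: the new value of \<open>F\<close> stays
      below \<open>c\<close>, the old value of \<open>\<Phi>\<close> above.\<close>
    define c where "c = (F x + \<Phi> x) / 2"
    have c: "F x < c" "c < \<Phi> x"
      using less by (simp_all add: c_def)
    have kM: "k ` (V \<inter> L) \<subseteq> M"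
      using slice_chart_slice_inverse[OF chart] by auto
    have contk: "continuous_on (V \<inter> L) k"
      using continuous_on_subset[OF C1_on_continuous_on[OF slice_chart_C1(2)[OF chart]]] by blast
    have cont: "continuous_on (V \<inter> L) (\<lambda>y. F (k y))" "continuous_on (V \<inter> L) (\<lambda>y. \<Phi> (k y))"
      using continuous_on_compose2[OF F contk kM] continuous_on_compose2[OF \<Phi>(1) contk kM] by simp_all
    have "\<exists>e>0. \<forall>y\<in>V \<inter> L. dist y (h x) < e \<longrightarrow> dist (F (k y)) (F (k (h x))) < c - F x"
      using cont(1) facts(7) c(1) unfolding continuous_on_iff by (metis diff_gt_0_iff_gt)
    then obtain e1 where e1: "e1 > 0" "\<And>y. y \<in> V \<inter> L \<Longrightarrow> dist y (h x) < e1 \<Longrightarrow> F (k y) < c"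
      unfolding kx by (auto simp: dist_real_def abs_less_iff)
    have "\<exists>e>0. \<forall>y\<in>V \<inter> L. dist y (h x) < e \<longrightarrow> dist (\<Phi> (k y)) (\<Phi> (k (h x))) < \<Phi> x - c"
      using cont(2) facts(7) c(2) unfolding continuous_on_iff by (metis diff_gt_0_iff_gt)
    then obtain e2 where e2: "e2 > 0" "\<And>y. y \<in> V \<inter> L \<Longrightarrow> dist y (h x) < e2 \<Longrightarrow> c < \<Phi> (k y)"
      unfolding kx by (auto simp: dist_real_def abs_less_iff)
    obtain e3 where e3: "e3 > 0" "cball (h x) e3 \<subseteq> V"
      using facts(4,7) by (meson IntD1 open_contains_cball)
    define r where "r = min (min (e1 / 2) (e2 / 2)) e3"
    have r: "r > 0" "cball (h x) r \<subseteq> V"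
      using e1(1) e2(1) e3 by (auto simp: r_def)
    have "F (k (y + s *\<^sub>R l)) < \<Phi> (k y)"
      if "y \<in> L" "y \<in> cball (h x) r" "y + s *\<^sub>R l \<in> cball (h x) r" for y s
    proof -
      have "dist (y + s *\<^sub>R l) (h x) < e1" "dist y (h x) < e2"
        using that(2,3) e1(1) e2(1) by (auto simp: r_def dist_commute)
      moreover have "y + s *\<^sub>R l \<in> V \<inter> L" "y \<in> V \<inter> L"
        using that r(2) step by auto
      ultimately show ?thesis
        using e1(2) e2(2) by (meson less_trans)
    qed
    then show ?thesis
      using r by (intro exI[of _ r]) blast
  }
  {
    assume "\<exists>g. C1_at M p g x \<and> frechet_derivative g (at x) (frechet_derivative k (at (h x)) l) < 0"
    then obtain g W where W: "open W" "x \<in> W" "C1_on W g" "\<forall>y\<in>M \<inter> W. p y = g y"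
      and neg: "frechet_derivative g (at x) (frechet_derivative k (at (h x)) l) < 0"
      unfolding C1_at_def by (elim exE conjE)
    \<comment> \<open>On \<open>N\<close> the extension \<open>g\<close> can be read in the chart.
      That \<open>p (k y)\<close> equals \<open>g (k y)\<close> is known only for \<open>y\<close>
      in \<open>L\<close>, which a motion in direction \<open>l\<close> never leaves.\<close>
    define N where "N = V \<inter> k -` W"
    have N: "open N" "h x \<in> N" "N \<subseteq> V" "k ` N \<subseteq> W"
      using continuous_open_preimage[OF C1_on_continuous_on[OF slice_chart_C1(2)[OF chart]] facts(4) W(1)]
        facts(7) kx W(2) by (auto simp: N_def)
    have CN: "C1_on N k"
      by (rule C1_on_subset[OF slice_chart_C1(2)[OF chart] N(3)])
    have "frechet_derivative (\<lambda>y. g (k y)) (at (h x)) l < 0"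
      using neg by (simp add: C1_on_compose(2)[OF CN W(3) N(4,2)] kx)
    from C1_descent[OF N(1,2) C1_on_compose(1)[OF CN W(3) N(4)] this]
    obtain r where r: "r > 0" "cball (h x) r \<subseteq> N"
      "\<forall>y s. y \<in> cball (h x) r \<longrightarrow> 0 < s \<longrightarrow> y + s *\<^sub>R l \<in> cball (h x) r \<longrightarrow> g (k (y + s *\<^sub>R l)) < g (k y)"
      by (elim exE conjE)
    have pg: "p (k y) = g (k y)" "k y \<in> M" if "y \<in> L" "y \<in> cball (h x) r" for y
    proof -
      have "y \<in> N"
        using that r(2) by blast
      then show "k y \<in> M"
        using slice_chart_slice_inverse[OF chart] that N(3) by blast
      then show "p (k y) = g (k y)"
        using W(4) N(4) \<open>y \<in> N\<close> by blast
    qed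
    have "F (k (y + s *\<^sub>R l)) < \<Phi> (k y)"
      if "y \<in> L" "y \<in> cball (h x) r" "0 < s" "y + s *\<^sub>R l \<in> cball (h x) r" for y s
    proof -
      have "g (k (y + s *\<^sub>R l)) < g (k y)"
        using r(3) that by blast
      then have "p (k (y + s *\<^sub>R l)) < p (k y)"
        using pg(1) that step by simp
      then have "F (k (y + s *\<^sub>R l)) < F (k y)"
        by (rule mono)
      also have "\<dots> \<le> \<Phi> (k y)"
        using \<Phi>(2) pg(2) that by blast
      finally show ?thesis .
    qed
    moreover have "cball (h x) r \<subseteq> V"
      using r(2) N(3) by blast
    ultimately show ?thesis
      using r(1) by (intro exI[of _ r]) blast
  }
qed
text \<open>The direction is minus the sum of the two unit vectors. Both products are negative as
  soon as \<open>- (u \<bullet> v) < norm u * norm v\<close>; equality in Cauchy-Schwarz for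
  \<open>u\<close> and \<open>- v\<close> would make \<open>u\<close> a nonpositive multiple of
  \<open>v\<close>.\<close>

lemma descent_direction_pair:
  fixes u v :: "'a::real_inner"
  assumes "u \<noteq> 0" "v \<noteq> 0" "\<And>c. c \<le> 0 \<Longrightarrow> u \<noteq> c *\<^sub>R v"
  shows "u \<bullet> (- (u /\<^sub>R norm u + v /\<^sub>R norm v)) < 0" "v \<bullet> (- (u /\<^sub>R norm u + v /\<^sub>R norm v)) < 0"
proof -
  have "- (u \<bullet> v) \<noteq> norm u * norm v"
  proof
    assume "- (u \<bullet> v) = norm u * norm v"
    then have "u \<bullet> (- v) = norm u * norm (- v)"
      by simp
    then have "norm u *\<^sub>R (- v) = norm (- v) *\<^sub>R u"
      by (simp only: norm_cauchy_schwarz_eq)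
    then have "norm v *\<^sub>R u = - norm u *\<^sub>R v"
      by simp
    moreover have "u = (1 / norm v) *\<^sub>R (norm v *\<^sub>R u)"
      using assms(2) by simp
    ultimately have "u = (- norm u / norm v) *\<^sub>R v"
      by simp
    moreover have "- norm u / norm v \<le> 0"
      by simp
    ultimately show False
      using assms(3) by blast
  qed
  moreover have "- (u \<bullet> v) \<le> norm u * norm v"
    using Cauchy_Schwarz_ineq2[of u v] by linarith
  ultimately have less: "- (u \<bullet> v) < norm u * norm v"
    by simp
  have expand: "w \<bullet> (- (u /\<^sub>R norm u + v /\<^sub>R norm v)) = - ((w \<bullet> u) / norm u + (w \<bullet> v) / norm v)" for w
    by (simp only: inner_minus_right inner_add_right inner_scaleR_right divide_inverse mult.commute)
  have self: "(w \<bullet> w) / norm w = norm w" for w :: 'a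
    by (simp add: dot_square_norm power2_eq_square)
  have "- (u \<bullet> v) / norm v < norm u" "- (u \<bullet> v) / norm u < norm v"
    using less assms(1,2) by (subst pos_divide_less_eq; simp add: mult.commute)+
  then show "u \<bullet> (- (u /\<^sub>R norm u + v /\<^sub>R norm v)) < 0" "v \<bullet> (- (u /\<^sub>R norm u + v /\<^sub>R norm v)) < 0"
    unfolding expand self by (simp_all add: inner_commute)
qed

lemma C1_at_continuous:
  assumes "C1_at M p g x" "x \<in> M"
  shows "continuous (at x within M) p"
proof -
  obtain W where W: "open W" "x \<in> W" "C1_on W g" "\<forall>y\<in>M \<inter> W. p y = g y"
    using assms(1) unfolding C1_at_def by (elim exE conjE)
  have "continuous_on W g"
    by (rule C1_on_continuous_on[OF W(3)])
  then have "isCont g x"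
    using W(1,2) by (simp add: continuous_on_eq_continuous_at)
  then have g: "continuous (at x within M) g"
    by (rule continuous_at_imp_continuous_at_within)
  obtain d where "d > 0" "ball x d \<subseteq> W"
    using W(1,2) openE by blast
  then show ?thesis
    by (intro continuous_transform_within[OF g, of d])
      (use assms(2) W(4) in \<open>auto simp: subset_iff dist_commute\<close>)
qed

lemma smooth_on_components_continuous_on:
  fixes \<phi> :: "'a::euclidean_space \<Rightarrow> real \<times> real"
  assumes "smooth_on M \<phi>"
  shows "continuous_on M (fst \<circ> \<phi>)" "continuous_on M (snd \<circ> \<phi>)"
  using smooth_on_components_C1_at[OF assms] C1_at_continuous
  by (meson continuous_on_eq_continuous_within)+

text \<open>One tangent vector serves both terms, and both descents hold on the smaller of two balls
  in the chart. Monotonicity transfers descent from \<open>p1\<close> and \<open>p2\<close> to their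
  rescaled versions \<open>F1\<close> and \<open>F2\<close> without differentiating the
  latter.\<close>

lemma manifold_max_local_deformation:
  fixes M :: "'a::euclidean_space set" and p1 p2 F1 F2 :: "'a \<Rightarrow> real"
  assumes M: "smooth_submanifold m M" "compact M" and x: "x \<in> M"
    and C1: "\<exists>g. C1_at M p1 g x" "\<exists>g. C1_at M p2 g x"
    and cont: "continuous_on M F1" "continuous_on M F2"
    and mono: "\<And>y z. p1 y < p1 z \<Longrightarrow> F1 y < F1 z" "\<And>y z. p2 y < p2 z \<Longrightarrow> F2 y < F2 z"
    and v: "v \<in> tangent_space M x"
    and alt: "F1 x < F2 x \<or> manifold_gradient M p1 x \<bullet> v < 0" "F2 x < F1 x \<or> manifold_gradient M p2 x \<bullet> v < 0"
  shows "\<exists>W H. open W \<and> x \<in> W \<and> downward_deformation M (\<lambda>y. max (F1 y) (F2 y)) H \<and>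
    (\<forall>y\<in>M \<inter> W. max (F1 (H (1, y))) (F2 (H (1, y))) < max (F1 y) (F2 y))"
proof -
  obtain U V L h k where chart: "slice_chart M x U V L h k"
    by (rule smooth_submanifold_slice_chart[OF M(1) x])
  obtain l where l: "l \<in> L" "v = frechet_derivative k (at (h x)) l"
    using v unfolding tangent_space_slice_chart[OF chart] by (elim imageE)
  let ?f = "\<lambda>y. max (F1 y) (F2 y)"
  have cont_max: "continuous_on M ?f"
    using cont by (rule continuous_on_max)
  have alt1: "F1 x < ?f x \<or> (\<exists>g. C1_at M p1 g x \<and> frechet_derivative g (at x) (frechet_derivative k (at (h x)) l) < 0)"
    using alt(1) C1(1) manifold_gradient_inner(2)[OF M(1) x _ v] l(2) by fastforce
  have alt2: "F2 x < ?f x \<or> (\<exists>g. C1_at M p2 g x \<and> frechet_derivative g (at x) (frechet_derivative k (at (h x)) l) < 0)"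
    using alt(2) C1(2) manifold_gradient_inner(2)[OF M(1) x _ v] l(2) by fastforce
  have "\<exists>r>0. cball (h x) r \<subseteq> V \<and> (\<forall>y s. y \<in> L \<longrightarrow> y \<in> cball (h x) r \<longrightarrow> 0 < s \<longrightarrow>
     y + s *\<^sub>R l \<in> cball (h x) r \<longrightarrow> F1 (k (y + s *\<^sub>R l)) < ?f (k y))"
    by (rule slice_chart_component_descent[where p = p1, OF chart l(1) cont(1) cont_max])
      (simp, erule mono(1), rule alt1)
  then obtain r1 where r1: "r1 > 0" "cball (h x) r1 \<subseteq> V" "\<forall>y s. y \<in> L \<longrightarrow> y \<in> cball (h x) r1 \<longrightarrow> 0 < s \<longrightarrow>
     y + s *\<^sub>R l \<in> cball (h x) r1 \<longrightarrow> F1 (k (y + s *\<^sub>R l)) < ?f (k y)"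
    by (elim exE conjE)
  have "\<exists>r>0. cball (h x) r \<subseteq> V \<and> (\<forall>y s. y \<in> L \<longrightarrow> y \<in> cball (h x) r \<longrightarrow> 0 < s \<longrightarrow>
     y + s *\<^sub>R l \<in> cball (h x) r \<longrightarrow> F2 (k (y + s *\<^sub>R l)) < ?f (k y))"
    by (rule slice_chart_component_descent[where p = p2, OF chart l(1) cont(2) cont_max])
      (simp, erule mono(2), rule alt2)
  then obtain r2 where r2: "r2 > 0" "cball (h x) r2 \<subseteq> V" "\<forall>y s. y \<in> L \<longrightarrow> y \<in> cball (h x) r2 \<longrightarrow> 0 < s \<longrightarrow>
     y + s *\<^sub>R l \<in> cball (h x) r2 \<longrightarrow> F2 (k (y + s *\<^sub>R l)) < ?f (k y)"
    by (elim exE conjE)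
  show ?thesis
  proof (rule slice_chart_downward_deformation[OF chart M(2) _ _ l(1)])
    show "0 < min r1 r2"
      using r1(1) r2(1) by simp
    have sub: "cball (h x) (min r1 r2) \<subseteq> cball (h x) r1" "cball (h x) (min r1 r2) \<subseteq> cball (h x) r2"
      by auto
    show "cball (h x) (min r1 r2) \<subseteq> V"
      using sub(1) r1(2) by (rule subset_trans)
    show "max (F1 (k (y + s *\<^sub>R l))) (F2 (k (y + s *\<^sub>R l))) < max (F1 (k y)) (F2 (k y))"
      if "y \<in> L" "y \<in> cball (h x) (min r1 r2)" "0 < s" "y + s *\<^sub>R l \<in> cball (h x) (min r1 r2)" for y s
    proof -
      have "F1 (k (y + s *\<^sub>R l)) < ?f (k y)"
        using r1(3) that subsetD[OF sub(1)] by blast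
      moreover have "F2 (k (y + s *\<^sub>R l)) < ?f (k y)"
        using r2(3) that subsetD[OF sub(2)] by blast
      ultimately show ?thesis
        by simp
    qed
  qed
qed

section \<open>Cornerpoints\<close>

lemma sublevel_subset: "sublevel M f v \<subseteq> M"
  by (auto simp: sublevel_def)

lemma sublevel_mono: "u \<le> v \<Longrightarrow> sublevel M f u \<subseteq> sublevel M f v"
  by (auto simp: sublevel_def)

lemma downward_deformation_sublevel:
  assumes "downward_deformation M f H"
  shows "H ` ({0..1} \<times> sublevel M f v) \<subseteq> sublevel M f v"
proof
  fix z assume "z \<in> H ` ({0..1} \<times> sublevel M f v)"
  then obtain t x where "0 \<le> t" "t \<le> 1" "x \<in> M" "ereal (f x) \<le> v" "z = H (t, x)"
    by (auto simp: sublevel_def)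
  moreover from this have "ereal (f z) \<le> ereal (f x)"
    using downward_deformationD(5)[OF assms] by simp
  then have "ereal (f z) \<le> v"
    using \<open>ereal (f x) \<le> v\<close> by (rule order_trans)
  ultimately show "z \<in> sublevel M f v"
    using downward_deformationD(3)[OF assms] by (simp add: sublevel_def)
qed

context
  fixes M :: "'a::topological_space set" and f :: "'a \<Rightarrow> real" and H w \<epsilon>
  assumes H: "downward_deformation M f H"
    and push: "\<And>x. x \<in> M \<Longrightarrow> f x \<le> w + \<epsilon> \<Longrightarrow> f (H (1, x)) \<le> w - \<epsilon>"
begin

lemma push_sublevel:
  assumes "w - \<epsilon> \<le> u1" "u2 \<le> w + \<epsilon>" "x \<in> sublevel M f (ereal u2)"
  shows "H (1, x) \<in> sublevel M f (ereal u1)"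
proof -
  have "x \<in> M" "f x \<le> w + \<epsilon>"
    using assms(2,3) by (simp_all add: sublevel_def)
  then show ?thesis
    using push[of x] downward_deformationD(3)[OF H, of x 1] assms(1) by (simp add: sublevel_def)
qed

text \<open>The end map pushes the larger sublevel set into the smaller one. The target level is an
  extended real so that the rank into the whole space, which defines cornerpoints at infinity, is
  covered.\<close>

lemma pers_betti_push_source:
  assumes "w - \<epsilon> \<le> u1" "u1 \<le> u2" "u2 \<le> w + \<epsilon>" "ereal u2 \<le> v"
  shows "pers_betti k M f u1 v = pers_betti k M f u2 v"
  unfolding pers_betti_def
proof (rule incl_rank2_homotopy_source)
  show "continuous_on ({0..1} \<times> sublevel M f (ereal u2)) H"
    by (rule continuous_on_subset[OF downward_deformationD(1)[OF H] Sigma_mono[OF order_refl sublevel_subset]])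
  show "H (0, x) = x" if "x \<in> sublevel M f (ereal u2)" for x
    by (rule downward_deformationD(2)[OF H subsetD[OF sublevel_subset that]])
  show "sublevel M f (ereal u1) \<subseteq> sublevel M f (ereal u2)" "sublevel M f (ereal u2) \<subseteq> sublevel M f v"
    using assms(2,4) by (intro sublevel_mono; simp)+
  show "H ` ({0..1} \<times> sublevel M f (ereal u2)) \<subseteq> sublevel M f (ereal u2)"
    by (rule downward_deformation_sublevel[OF H])
  show "H (1, x) \<in> sublevel M f (ereal u1)" if "x \<in> sublevel M f (ereal u2)" for x
    by (rule push_sublevel[OF assms(1,3) that])
qed

text \<open>Here the homotopy has to preserve the sublevel set at \<open>u\<close> as well, and a
  downward deformation preserves every sublevel set.\<close>

lemma pers_betti_push_target:
  assumes "w - \<epsilon> \<le> v1" "v1 \<le> v2" "v2 \<le> w + \<epsilon>" "u \<le> v1"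
  shows "pers_betti k M f u (ereal v1) = pers_betti k M f u (ereal v2)"
  unfolding pers_betti_def
proof (rule incl_rank2_homotopy_target)
  show "continuous_on ({0..1} \<times> sublevel M f (ereal v2)) H"
    by (rule continuous_on_subset[OF downward_deformationD(1)[OF H] Sigma_mono[OF order_refl sublevel_subset]])
  show "H (0, x) = x" if "x \<in> sublevel M f (ereal v2)" for x
    by (rule downward_deformationD(2)[OF H subsetD[OF sublevel_subset that]])
  show "sublevel M f (ereal u) \<subseteq> sublevel M f (ereal v1)" "sublevel M f (ereal v1) \<subseteq> sublevel M f (ereal v2)"
    using assms(2,4) by (intro sublevel_mono; simp)+
  show "H ` ({0..1} \<times> sublevel M f (ereal u)) \<subseteq> sublevel M f (ereal u)"
    by (rule downward_deformation_sublevel[OF H])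
  show "H (1, x) \<in> sublevel M f (ereal v1)" if "x \<in> sublevel M f (ereal v2)" for x
    by (rule push_sublevel[OF assms(1,3) that])
qed

lemma push_not_finite_coordinate:
  assumes \<epsilon>: "\<epsilon> > 0" and P: "P \<in> Dgm_points k M f - {Trivial}"
  shows "w \<notin> finite_coordinates P"
proof
  assume w: "w \<in> finite_coordinates P"
  \<comment> \<open>Belonging to the diagram means positive multiplicity, so it is enough that the
    function under \<open>Lim\<close> vanishes on an interval to the right of 0.\<close>
  have Lim0: "Lim (at_right (0::real)) g = 0"
    if "d > 0" "\<And>e. 0 < e \<Longrightarrow> e < d \<Longrightarrow> g e = 0" for g :: "real \<Rightarrow> int" and d :: real
  proof (rule tendsto_Lim)
    have "eventually (\<lambda>e. g e = 0) (at_right 0)"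
      unfolding eventually_at_right_field using that by blast
    then show "(g \<longlongrightarrow> 0) (at_right 0)"
      by (rule tendsto_eventually)
  qed simp
  show False
  proof (cases P)
    case (Proper u v)
    then have uv: "u < v" "proper_mult k M f u v > 0"
      using P by (auto simp: Dgm_points_def Dgm_def zero_enat_def split: if_splits)
    have "proper_mult k M f u v = 0"
      unfolding proper_mult_def
    proof (rule Lim0)
      \<comment> \<open>The bound \<open>(v - u) / 2\<close> keeps \<open>u + e\<close> below
        \<open>v - e\<close>, so that all four ranks belong to inclusions of sublevel sets.\<close>
      show "min \<epsilon> ((v - u) / 2) > 0"
        using \<epsilon> uv(1) by simp
      fix e assume e: "0 < e" "e < min \<epsilon> ((v - u) / 2)"
      \<comment> \<open>For \<open>w = u\<close> the terms cancel in pairs with equal second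
        argument, for \<open>w = v\<close> in pairs with equal first argument.\<close>
      consider "w = u" | "w = v"
        using w Proper by auto
      then show "int (pers_betti k M f (u + e) (ereal (v - e))) - int (pers_betti k M f (u - e) (ereal (v - e)))
        + int (pers_betti k M f (u - e) (ereal (v + e))) - int (pers_betti k M f (u + e) (ereal (v + e))) = 0"
      proof cases
        case 1
        have "pers_betti k M f (u - e) (ereal (v - e)) = pers_betti k M f (u + e) (ereal (v - e))"
          "pers_betti k M f (u - e) (ereal (v + e)) = pers_betti k M f (u + e) (ereal (v + e))"
          using e 1 by (auto intro!: pers_betti_push_source)
        then show ?thesis
          by simp
      next
        case 2
        have "pers_betti k M f (u - e) (ereal (v - e)) = pers_betti k M f (u - e) (ereal (v + e))"
          "pers_betti k M f (u + e) (ereal (v - e)) = pers_betti k M f (u + e) (ereal (v + e))"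
          using e 2 by (auto intro!: pers_betti_push_target)
        then show ?thesis
          by simp
      qed
    qed
    with uv(2) show False
      by simp
  next
    case (At_Infinity u)
    then have "infinite_mult k M f u > 0"
      using P by (auto simp: Dgm_points_def Dgm_def zero_enat_def)
    moreover have "infinite_mult k M f u = 0"
      unfolding infinite_mult_def
    proof (rule Lim0[OF \<epsilon>])
      fix e assume "0 < e" "e < \<epsilon>"
      then have "pers_betti k M f (u - e) \<infinity> = pers_betti k M f (u + e) \<infinity>"
        using w At_Infinity by (intro pers_betti_push_source) auto
      then show "int (pers_betti k M f (u + e) \<infinity>) - int (pers_betti k M f (u - e) \<infinity>) = 0"
        by simp
    qed
    ultimately show False
      by simp
  next
    case Trivial
    with P show False
      by simp
  qed
qed

end

text \<open>These directions answer the three cases of a point on the level: one term active, the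
  other one active, or both. Gradients are tangent vectors, so the directions built from them are
  tangent as well.\<close>

lemma smooth_components_descent:
  fixes M :: "'a::euclidean_space set" and \<phi> :: "'a \<Rightarrow> real \<times> real"
  assumes M: "smooth_submanifold m M" "smooth_on M \<phi>" and x: "x \<in> M"
  shows "grad1 M \<phi> x \<noteq> 0 \<Longrightarrow> \<exists>v\<in>tangent_space M x. grad1 M \<phi> x \<bullet> v < 0"
    and "grad2 M \<phi> x \<noteq> 0 \<Longrightarrow> \<exists>v\<in>tangent_space M x. grad2 M \<phi> x \<bullet> v < 0"
    and "x \<notin> pareto_critical M \<phi> \<Longrightarrow>
      \<exists>v\<in>tangent_space M x. grad1 M \<phi> x \<bullet> v < 0 \<and> grad2 M \<phi> x \<bullet> v < 0"
proof -
  obtain U V L h k where chart: "slice_chart M x U V L h k"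
    by (rule smooth_submanifold_slice_chart[OF M(1) x])
  have T: "subspace (tangent_space M x)"
    by (rule subspace_tangent_space[OF chart])
  obtain g1 g2 where C1: "C1_at M (fst \<circ> \<phi>) g1 x" "C1_at M (snd \<circ> \<phi>) g2 x"
    using smooth_on_components_C1_at[OF M(2) x] by (elim exE)
  note in_T = manifold_gradient_inner(1)[OF M(1) x C1(1)] manifold_gradient_inner(1)[OF M(1) x C1(2)]
  show "\<exists>v\<in>tangent_space M x. grad1 M \<phi> x \<bullet> v < 0" if "grad1 M \<phi> x \<noteq> 0"
    using that in_T(1) T by (intro bexI[of _ "- grad1 M \<phi> x"]) (simp_all add: subspace_neg)
  show "\<exists>v\<in>tangent_space M x. grad2 M \<phi> x \<bullet> v < 0" if "grad2 M \<phi> x \<noteq> 0"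
    using that in_T(2) T by (intro bexI[of _ "- grad2 M \<phi> x"]) (simp_all add: subspace_neg)
  assume "x \<notin> pareto_critical M \<phi>"
  then have not: "grad1 M \<phi> x \<noteq> c *\<^sub>R grad2 M \<phi> x" "grad2 M \<phi> x \<noteq> c *\<^sub>R grad1 M \<phi> x" if "c \<le> 0" for c
    using x that by (auto simp: pareto_critical_def)
  \<comment> \<open>The Pareto condition admits the multiplier 0, so a point with a vanishing
    gradient is Pareto critical.\<close>
  from not(1)[of 0] not(2)[of 0] have nonzero: "grad1 M \<phi> x \<noteq> 0" "grad2 M \<phi> x \<noteq> 0"
    by simp_all
  let ?v = "- (grad1 M \<phi> x /\<^sub>R norm (grad1 M \<phi> x) + grad2 M \<phi> x /\<^sub>R norm (grad2 M \<phi> x))"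
  have "?v \<in> tangent_space M x"
    using in_T by (intro subspace_neg subspace_add subspace_scale T)
  then show "\<exists>v\<in>tangent_space M x. grad1 M \<phi> x \<bullet> v < 0 \<and> grad2 M \<phi> x \<bullet> v < 0"
    using descent_direction_pair[OF nonzero not(1)] by (intro bexI[of _ ?v] conjI)
qed

theorem theorem10:
  fixes M :: "'a::euclidean_space set"
    and \<phi> :: "'a \<Rightarrow> real \<times> real"
    and m k :: nat
    and a b w :: real
    and P :: cornerpoint
  assumes "m \<ge> 2"
    and "smooth_submanifold m M"
    and "compact M"
    and "M \<noteq> {}"
    and "smooth_on M \<phi>"
    and "finite_sublevel_homology M \<phi> k"
    and "right_continuous_betti M \<phi> k"
    and "regular_pareto_set M \<phi>"
    and "regular_contour_arcs M \<phi> k"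
    and "0 < a" and "a < 1"
    and "P \<in> Dgm_points k M (phi_star \<phi> a b) - {Trivial}"
    and "w \<in> finite_coordinates P"
  shows "\<exists>A \<in> filter_line a b \<inter> pareto_grid M \<phi>.
           w = min a (1 - a) / a * (fst A - b) \<and>
           w = min a (1 - a) / (1 - a) * (snd A + b)"
proof -
  define \<mu> where "\<mu> = min a (1 - a)"
  \<comment> \<open>Both formulas of the conclusion are solved for the coordinates of
    \<open>A\<close>; since \<open>w / \<mu>\<close> is a common parameter, \<open>A\<close> is on
    the line, and only membership in the grid is at stake.\<close>
  define A where "A = (w / \<mu> * a + b, w / \<mu> * (1 - a) - b)"
  have \<mu>: "\<mu> > 0" "a > 0" "1 - a > 0"
    using assms(10,11) by (simp_all add: \<mu>_def)
  have "A \<in> pareto_grid M \<phi>"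
  proof (rule ccontr)
    assume notin: "A \<notin> pareto_grid M \<phi>"
    define F1 where "F1 y = \<mu> * ((fst (\<phi> y) - b) / a)" for y
    define F2 where "F2 y = \<mu> * ((snd (\<phi> y) + b) / (1 - a))" for y
    have f: "phi_star \<phi> a b = (\<lambda>y. max (F1 y) (F2 y))"
      using \<mu>(1) by (auto simp: phi_star_def F1_def F2_def \<mu>_def[symmetric] max_mult_distrib_left fun_eq_iff)
    \<comment> \<open>Both terms meet the level \<open>w\<close> exactly at the coordinates of
      \<open>A\<close>, so the sublevel set at \<open>w\<close> is the part of M sent weakly below
      and to the left of \<open>A\<close>.\<close>
    have level: "F1 y = w \<longleftrightarrow> fst (\<phi> y) = fst A" "F1 y \<le> w \<longleftrightarrow> fst (\<phi> y) \<le> fst A"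
      "F2 y = w \<longleftrightarrow> snd (\<phi> y) = snd A" "F2 y \<le> w \<longleftrightarrow> snd (\<phi> y) \<le> snd A" for y
      using \<mu> by (auto simp: F1_def F2_def A_def field_simps)
    have mono: "F1 y < F1 z" if "(fst \<circ> \<phi>) y < (fst \<circ> \<phi>) z" for y z
      using that \<mu> by (simp add: F1_def divide_strict_right_mono)
    have mono': "F2 y < F2 z" if "(snd \<circ> \<phi>) y < (snd \<circ> \<phi>) z" for y z
      using that \<mu> by (simp add: F2_def divide_strict_right_mono)
    note cont\<phi> = smooth_on_components_continuous_on[OF assms(5)]
    have cont: "continuous_on M F1" "continuous_on M F2"
      unfolding F1_def F2_def using cont\<phi> \<mu>(2,3) unfolding comp_def
      by (auto intro!: continuous_on_mult continuous_on_divide continuous_on_diff continuous_on_add continuous_on_const)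
    let ?f = "\<lambda>y. max (F1 y) (F2 y)"
    have direction: "\<exists>v\<in>tangent_space M x. (F1 x < F2 x \<or> grad1 M \<phi> x \<bullet> v < 0) \<and> (F2 x < F1 x \<or> grad2 M \<phi> x \<bullet> v < 0)"
      if x: "x \<in> M" "?f x = w" for x
    proof -
      have le: "fst (\<phi> x) \<le> fst A" "snd (\<phi> x) \<le> snd A"
        using x(2) level[of x] by auto
      note dir = smooth_components_descent[OF assms(2,5) x(1)]
      consider "F1 x < F2 x" | "F2 x < F1 x" | "F1 x = F2 x"
        by linarith
      then show ?thesis
      proof cases
        case 1
        then have "snd (\<phi> x) = snd A"
          using x(2) level(3)[of x] by simp
        \<comment> \<open>The inactive coordinate supplies the inequality that places
          \<open>A\<close> on the half-line and not merely on the full line.\<close>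
        then have "A \<in> horizontal_half_line \<phi> x"
          using le unfolding horizontal_half_line_def mem_Collect_eq case_prod_beta by simp
        then have "x \<notin> critical_points M (snd \<circ> \<phi>)"
          using notin by (auto simp: pareto_grid_def)
        then have "grad2 M \<phi> x \<noteq> 0"
          using x(1) by (simp add: critical_points_def)
        from dir(2)[OF this] show ?thesis
          using 1 by auto
      next
        case 2
        then have "fst (\<phi> x) = fst A"
          using x(2) level(1)[of x] by simp
        then have "A \<in> vertical_half_line \<phi> x"
          using le unfolding vertical_half_line_def mem_Collect_eq case_prod_beta by simp
        then have "x \<notin> critical_points M (fst \<circ> \<phi>)"
          using notin by (auto simp: pareto_grid_def)
        then have "grad1 M \<phi> x \<noteq> 0"
          using x(1) by (simp add: critical_points_def)
        from dir(1)[OF this] show ?thesis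
          using 2 by auto
      next
        case 3
        then have "\<phi> x = A"
          using x(2) level(1,3)[of x] by (simp add: prod_eq_iff)
        then have "x \<notin> pareto_critical M \<phi>"
          using notin by (auto simp: pareto_grid_def)
        from dir(3)[OF this] show ?thesis
          by blast
      qed
    qed
    \<comment> \<open>Strictness is arranged on the level set only: below it monotonicity suffices,
      and points above it keep their distance from the level in the compactness argument of
      \<open>downward_deformation_push\<close>.\<close>
    define K where "K = {x \<in> M. ?f x = w}"
    have contf: "continuous_on M ?f"
      using cont by (rule continuous_on_max)
    have "closed (M \<inter> ?f -` {w})"
      by (rule continuous_closed_preimage[OF contf compact_imp_closed[OF assms(3)] closed_singleton])
    then have "compact K"
      using compact_Int_closed[OF assms(3), of "M \<inter> ?f -` {w}"] by (simp add: K_def vimage_def Int_def)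
    have "\<exists>H. downward_deformation M ?f H \<and> (\<forall>y\<in>K. ?f (H (1, y)) < ?f y)"
    proof (rule downward_deformation_cover[OF \<open>compact K\<close>])
      show "K \<subseteq> M"
        by (auto simp: K_def)
      fix x assume "x \<in> K"
      then have x: "x \<in> M" "?f x = w"
        by (simp_all add: K_def)
      from direction[OF x] obtain v where v: "v \<in> tangent_space M x"
        "F1 x < F2 x \<or> grad1 M \<phi> x \<bullet> v < 0" "F2 x < F1 x \<or> grad2 M \<phi> x \<bullet> v < 0"
        by (elim bexE conjE)
      show "\<exists>V H. open V \<and> x \<in> V \<and> downward_deformation M ?f H \<and> (\<forall>y\<in>M \<inter> V. ?f (H (1, y)) < ?f y)"
        by (rule manifold_max_local_deformation[where ?p1.0 = "fst \<circ> \<phi>" and ?p2.0 = "snd \<circ> \<phi>",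
              OF assms(2,3) x(1) smooth_on_components_C1_at[OF assms(5) x(1)] cont _ _ v])
          (erule mono mono')+
    qed
    then obtain H where H: "downward_deformation M ?f H" "\<forall>y\<in>K. ?f (H (1, y)) < ?f y"
      by (elim exE conjE)
    have "\<exists>\<epsilon>>0. \<forall>x\<in>M. ?f x \<le> w + \<epsilon> \<longrightarrow> ?f (H (1, x)) \<le> w - \<epsilon>"
      by (rule downward_deformation_push[OF assms(3,4) contf H(1)])
        (use H(2) in \<open>simp add: K_def\<close>)
    then obtain \<epsilon> where \<epsilon>: "\<epsilon> > 0" "\<forall>x\<in>M. ?f x \<le> w + \<epsilon> \<longrightarrow> ?f (H (1, x)) \<le> w - \<epsilon>"
      by (elim exE conjE)
    have "w \<notin> finite_coordinates P"
      by (rule push_not_finite_coordinate[OF H(1) _ \<epsilon>(1) assms(12)[unfolded f]]) (use \<epsilon>(2) in blast)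
    then show False
      using assms(13) by contradiction
  qed
  moreover have "A \<in> filter_line a b"
    unfolding filter_line_def A_def by blast
  moreover have "w = \<mu> / a * (fst A - b)" "w = \<mu> / (1 - a) * (snd A + b)"
    using \<mu> by (simp_all add: A_def)
  ultimately show ?thesis
    unfolding \<mu>_def by blast
qed

end
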